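(* The map $ri_\tau:\overline X^S_\tau\to\{\text{rational maps of }\mathcal O\}$, which sends the point $p=[\tau_W(g)\tau_W(g)^*\oplus0]$ of $\overline X^S_\tau$ ($W$ a $\tau$-connected subspace, $g\in M(W)$) to the rational map $$R_{gW}:\mathcal O\dashrightarrow\mathcal O,\qquad [v]\mapsto\big[\sqrt{\tau_W(g)\tau_W(g)^*}\;\pi_W(v)\big],$$ is injective.
   Context: Setting: $G$ is a connected noncompact real semisimple Lie group with finite center, $K\subset G$ a maximal compact subgroup, $\theta$ the Cartan involution, $\mathfrak g=\mathfrak k\oplus\mathfrak p$ the Cartan decomposition, $X=G/K$, and $\tau:G\to \mathrm{SL}(V)$ an irreducible representation with finite kernel on a finite-dimensional complex vector space $V$. $h$ is a Hermitian scalar product on $V$ such that $\tau(G)$ is compatible with $\mathrm{SU}(V,h)^{\mathbb C}$, i.e. $\tau(K)\subset \mathrm{SU}(V,h)$, $\tau(\mathfrak p)\subset i\,\mathfrak{su}(V,h)$ and $\tau(G)=\tau(K)\exp(\tau(\mathfrak p))$. The orbit $\mathcal O$: let $U^{\mathbb C}$ be the Zariski closure of $\tau(G)$ in $\mathrm{SL}(V)$; it is complex semisimple, acts irreducibly on $V$, and has a unique closed orbit $\mathcal O'$ in $\mathbb P(V)$. $\mathcal O$ is the unique closed $G$-orbit contained in $\mathcal O'$; it is a $K$-orbit. $\tau$-connected subspaces: for a nonzero complex subspace $W\subseteq V$, $Q(W)=\{g\in G:\tau(g)W=W\}$; $W$ is $\tau$-connected if $Q(W)$ is parabolic and acts irreducibly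 on $W$. Put $L=Q(W)\cap\theta(Q(W))$, $\mathfrak l=\mathrm{Lie}(L)$, $\mathfrak a_Q=\mathfrak z(\mathfrak l)\cap\mathfrak p$ and $M(W)=(K\cap L)\exp(\mathfrak p\cap\mathfrak l\cap\mathfrak a_Q^\perp)$ ($\perp$ for the Killing form). For $g\in M(W)$, $\tau_W(g)=\tau(g)|_W$ and $\tau_W(g)^*$ is its adjoint on $(W,h|_W)$. $\pi_W:V\to W$ is the $h$-orthogonal projection. Satake compactification: $\mathcal H(V)$ is the real space of $h$-Hermitian endomorphisms; $\overline X^S_\tau$ is the closure in $\mathbb P(\mathcal H(V))$ of $\{[\tau(g)\tau(g)^*]:g\in G\}$. It is known that $\overline X^S_\tau$ is the disjoint union, over $\tau$-connected $W$, of the sets $\{[\tau_W(g)\tau_W(g)^*\oplus0]:g\in M(W)\}$, where $\oplus0$ is extension by zero on $W^\perp$. $R_{gW}$ is defined on the open dense subset $\mathcal O\setminus\mathbb P(W^\perp)$ and takes values in $\mathcal O$; two such maps are regarded as equal as rational maps if they agree where both are defined. *)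

theory Defs
  imports
    "HOL-Analysis.Analysis"
    "HOL-Algebra.Group"
    "HOL-Library.Function_Algebras"
begin

section \<open>Lie groups\<close>

primrec Ck_on :: "nat \<Rightarrow> 'a::real_normed_vector set \<Rightarrow> ('a \<Rightarrow> 'b::real_normed_vector) \<Rightarrow> bool" where
  "Ck_on 0 S f \<longleftrightarrow> continuous_on S f"
| "Ck_on (Suc k) S f \<longleftrightarrow>
     (\<forall>x\<in>S. f differentiable (at x)) \<and> (\<forall>v. Ck_on k S (\<lambda>x. frechet_derivative f (at x) v))"

text \<open>Only used for open \<open>S\<close>.\<close>
definition smooth_on :: "'a::real_normed_vector set \<Rightarrow> ('a \<Rightarrow> 'b::real_normed_vector) \<Rightarrow> bool" where
  "smooth_on S f \<longleftrightarrow> (\<forall>k. Ck_on k S f)"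

text \<open>A group together with a topology on its carrier and an atlas with values in the Euclidean
  space \<open>'e\<close>. A chart is a pair \<open>(U, \<phi>)\<close>; only the values of \<open>\<phi>\<close> on \<open>U\<close> matter.\<close>
record ('g, 'e) lie_struct = "'g monoid" +
  topol :: "'g topology"
  charts :: "('g set \<times> ('g \<Rightarrow> 'e)) set"

definition smooth_fun :: "('g, 'e::euclidean_space) lie_struct \<Rightarrow> ('g \<Rightarrow> 'b::real_normed_vector) \<Rightarrow> bool" where
  "smooth_fun G f \<longleftrightarrow> (\<forall>(U, \<phi>)\<in>charts G. smooth_on (\<phi> ` U) (f \<circ> inv_into U \<phi>))"

definition smooth_self_map :: "('g, 'e::euclidean_space) lie_struct \<Rightarrow> ('g \<Rightarrow> 'g) \<Rightarrow> bool" where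
  "smooth_self_map G F \<longleftrightarrow> continuous_map (topol G) (topol G) F \<and>
     (\<forall>(U, \<phi>)\<in>charts G. \<forall>(V, \<psi>)\<in>charts G.
        smooth_on (\<phi> ` {x \<in> U. F x \<in> V}) (\<psi> \<circ> F \<circ> inv_into U \<phi>))"

definition smooth_mult :: "('g, 'e::euclidean_space) lie_struct \<Rightarrow> bool" where
  "smooth_mult G \<longleftrightarrow>
     continuous_map (prod_topology (topol G) (topol G)) (topol G) (\<lambda>(x, y). x \<otimes>\<^bsub>G\<^esub> y) \<and>
     (\<forall>(U, \<phi>)\<in>charts G. \<forall>(V, \<psi>)\<in>charts G. \<forall>(W, \<omega>)\<in>charts G.
        smooth_on
          {z \<in> \<phi> ` U \<times> \<psi> ` V. inv_into U \<phi> (fst z) \<otimes>\<^bsub>G\<^esub> inv_into V \<psi> (snd z) \<in> W}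
          (\<lambda>z. \<omega> (inv_into U \<phi> (fst z) \<otimes>\<^bsub>G\<^esub> inv_into V \<psi> (snd z))))"

definition lie_group :: "('g, 'e::euclidean_space) lie_struct \<Rightarrow> bool" where
  "lie_group G \<longleftrightarrow>
     group G \<and> topspace (topol G) = carrier G \<and>
     Hausdorff_space (topol G) \<and> second_countable (topol G) \<and>
     (\<Union>(U, \<phi>)\<in>charts G. U) = carrier G \<and>
     (\<forall>(U, \<phi>)\<in>charts G. openin (topol G) U \<and> open (\<phi> ` U) \<and>
        homeomorphic_map (subtopology (topol G) U) (top_of_set (\<phi> ` U)) \<phi>) \<and>
     (\<forall>(U, \<phi>)\<in>charts G. \<forall>(V, \<psi>)\<in>charts G. smooth_on (\<phi> ` (U \<inter> V)) (\<psi> \<circ> inv_into U \<phi>)) \<and>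
     smooth_mult G \<and> smooth_self_map G (m_inv G)"

definition group_center :: "('g, 'm) monoid_scheme \<Rightarrow> 'g set" where
  "group_center G = {z \<in> carrier G. \<forall>g\<in>carrier G. z \<otimes>\<^bsub>G\<^esub> g = g \<otimes>\<^bsub>G\<^esub> z}"

section \<open>The Lie algebra of left invariant vector fields\<close>

type_synonym 'g vfield = "('g \<Rightarrow> real) \<Rightarrow> ('g \<Rightarrow> real)"

definition ext_zero :: "('g, 'm) monoid_scheme \<Rightarrow> ('g \<Rightarrow> real) \<Rightarrow> ('g \<Rightarrow> real)" where
  "ext_zero G f = (\<lambda>x. if x \<in> carrier G then f x else 0)"

text \<open>Functions on \<open>G\<close> are normalised to vanish outside the carrier, and vector fields (derivations of
  the algebra of smooth functions) to vanish on everything that is not a smooth function; thus equality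
  in HOL is equality of functions on \<open>G\<close>, respectively of vector fields on \<open>G\<close>.\<close>
definition C_inf :: "('g, 'e::euclidean_space) lie_struct \<Rightarrow> ('g \<Rightarrow> real) set" where
  "C_inf G = {f. smooth_fun G f \<and> (\<forall>x. x \<notin> carrier G \<longrightarrow> f x = 0)}"

definition lie_algebra :: "('g, 'e::euclidean_space) lie_struct \<Rightarrow> 'g vfield set" where
  "lie_algebra G = {X.
     (\<forall>f. f \<notin> C_inf G \<longrightarrow> X f = (\<lambda>_. 0)) \<and>
     (\<forall>f\<in>C_inf G. X f \<in> C_inf G) \<and>
     (\<forall>f\<in>C_inf G. \<forall>k\<in>C_inf G. \<forall>a b. X (\<lambda>x. a * f x + b * k x) = (\<lambda>x. a * X f x + b * X k x)) \<and>
     (\<forall>f\<in>C_inf G. \<forall>k\<in>C_inf G. X (\<lambda>x. f x * k x) = (\<lambda>x. X f x * k x + f x * X k x)) \<and>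
     (\<forall>f\<in>C_inf G. \<forall>a\<in>carrier G.
        X (ext_zero G (\<lambda>x. f (a \<otimes>\<^bsub>G\<^esub> x))) = ext_zero G (\<lambda>x. X f (a \<otimes>\<^bsub>G\<^esub> x)))}"

definition vscale :: "real \<Rightarrow> 'g vfield \<Rightarrow> 'g vfield" where
  "vscale r X = (\<lambda>f x. r * X f x)"

definition vbracket :: "'g vfield \<Rightarrow> 'g vfield \<Rightarrow> 'g vfield" where
  "vbracket X Y = (\<lambda>f x. X (Y f) x - Y (X f) x)"

interpretation vf: vector_space "vscale :: real \<Rightarrow> 'g vfield \<Rightarrow> 'g vfield"
  by unfold_locales (auto simp: vscale_def fun_eq_iff algebra_simps)

text \<open>The complexification: \<open>(X, Y)\<close> stands for \<open>X + \<i>Y\<close>.\<close>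
definition cvscale :: "complex \<Rightarrow> 'g vfield \<times> 'g vfield \<Rightarrow> 'g vfield \<times> 'g vfield" where
  "cvscale c Z =
     (vscale (Re c) (fst Z) - vscale (Im c) (snd Z), vscale (Re c) (snd Z) + vscale (Im c) (fst Z))"

definition cvbracket :: "'g vfield \<times> 'g vfield \<Rightarrow> 'g vfield \<times> 'g vfield \<Rightarrow> 'g vfield \<times> 'g vfield" where
  "cvbracket Z Z' =
     (vbracket (fst Z) (fst Z') - vbracket (snd Z) (snd Z'),
      vbracket (fst Z) (snd Z') + vbracket (snd Z) (fst Z'))"

interpretation cvf: vector_space "cvscale :: complex \<Rightarrow> 'g vfield \<times> 'g vfield \<Rightarrow> 'g vfield \<times> 'g vfield"
  by unfold_locales (auto simp: cvscale_def vscale_def fun_eq_iff prod_eq_iff algebra_simps)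

text \<open>\<open>sp\<close> is the linear span and \<open>br\<close> the bracket; the iterates of \<open>derived\<close> are the derived series.\<close>
definition derived :: "('x set \<Rightarrow> 'x set) \<Rightarrow> ('x \<Rightarrow> 'x \<Rightarrow> 'x) \<Rightarrow> 'x set \<Rightarrow> 'x set" where
  "derived sp br S = sp {br x y |x y. x \<in> S \<and> y \<in> S}"

definition solvable :: "('x::zero set \<Rightarrow> 'x set) \<Rightarrow> ('x \<Rightarrow> 'x \<Rightarrow> 'x) \<Rightarrow> 'x set \<Rightarrow> bool" where
  "solvable sp br S \<longleftrightarrow> (\<exists>n. (derived sp br ^^ n) S = {0})"

definition lie_ideal :: "'g vfield set \<Rightarrow> 'g vfield set \<Rightarrow> bool" where
  "lie_ideal \<gg> I \<longleftrightarrow> I \<subseteq> \<gg> \<and> vf.subspace I \<and> (\<forall>X\<in>\<gg>. \<forall>Y\<in>I. vbracket X Y \<in> I)"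

definition semisimple_group :: "('g, 'e::euclidean_space) lie_struct \<Rightarrow> bool" where
  "semisimple_group G \<longleftrightarrow>
     (\<forall>I. lie_ideal (lie_algebra G) I \<and> solvable vf.span vbracket I \<longrightarrow> I = {0})"

text \<open>Trace of the endomorphism \<open>F\<close> of the finite-dimensional space \<open>S\<close>, computed in some basis.\<close>
definition vf_trace :: "'g vfield set \<Rightarrow> ('g vfield \<Rightarrow> 'g vfield) \<Rightarrow> real" where
  "vf_trace S F =
     (let B = (SOME B. vf.independent B \<and> vf.span B = S) in \<Sum>X\<in>B. vf.representation B (F X) X)"

definition killing :: "('g, 'e::euclidean_space) lie_struct \<Rightarrow> 'g vfield \<Rightarrow> 'g vfield \<Rightarrow> real" where
  "killing G X Y = vf_trace (lie_algebra G) (vbracket X \<circ> vbracket Y)"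

definition integral_curve :: "('g, 'e::euclidean_space) lie_struct \<Rightarrow> 'g vfield \<Rightarrow> (real \<Rightarrow> 'g) \<Rightarrow> bool" where
  "integral_curve G X \<gamma> \<longleftrightarrow> (\<forall>t. \<gamma> t \<in> carrier G) \<and>
     (\<forall>f\<in>C_inf G. \<forall>t. ((\<lambda>s. f (\<gamma> s)) has_real_derivative X f (\<gamma> t)) (at t))"

definition lie_exp :: "('g, 'e::euclidean_space) lie_struct \<Rightarrow> 'g vfield \<Rightarrow> 'g" where
  "lie_exp G X = (THE x. \<exists>\<gamma>. integral_curve G X \<gamma> \<and> \<gamma> 0 = \<one>\<^bsub>G\<^esub> \<and> x = \<gamma> 1)"

definition lie_of_subgroup :: "('g, 'e::euclidean_space) lie_struct \<Rightarrow> 'g set \<Rightarrow> 'g vfield set" where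
  "lie_of_subgroup G H = {X \<in> lie_algebra G. \<forall>t. lie_exp G (vscale t X) \<in> H}"

text \<open>The differential of an automorphism \<open>\<phi>\<close> of \<open>G\<close>: \<open>(\<phi>\<^sub>* X) f = X (f \<circ> \<phi>) \<circ> \<phi>\<inverse>\<close>.\<close>
definition push_forward :: "('g, 'e::euclidean_space) lie_struct \<Rightarrow> ('g \<Rightarrow> 'g) \<Rightarrow> 'g vfield \<Rightarrow> 'g vfield" where
  "push_forward G \<phi> X = (\<lambda>f. if f \<in> C_inf G
     then ext_zero G (\<lambda>x. X (ext_zero G (f \<circ> \<phi>)) (inv_into (carrier G) \<phi> x)) else (\<lambda>_. 0))"

definition Ad :: "('g, 'e::euclidean_space) lie_struct \<Rightarrow> 'g \<Rightarrow> 'g vfield \<Rightarrow> 'g vfield" where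
  "Ad G g = push_forward G (\<lambda>x. g \<otimes>\<^bsub>G\<^esub> x \<otimes>\<^bsub>G\<^esub> inv\<^bsub>G\<^esub> g)"

section \<open>Maximal compact subgroups, Cartan involutions, parabolic subgroups\<close>

definition maximal_compact_subgroup :: "('g, 'e::euclidean_space) lie_struct \<Rightarrow> 'g set \<Rightarrow> bool" where
  "maximal_compact_subgroup G K \<longleftrightarrow> subgroup K G \<and> compactin (topol G) K \<and>
     (\<forall>K'. subgroup K' G \<and> compactin (topol G) K' \<and> K \<subseteq> K' \<longrightarrow> K' = K)"

definition cartan_involution :: "('g, 'e::euclidean_space) lie_struct \<Rightarrow> ('g \<Rightarrow> 'g) \<Rightarrow> bool" where
  "cartan_involution G \<theta> \<longleftrightarrow> \<theta> \<in> hom G G \<and> smooth_self_map G \<theta> \<and> (\<forall>x\<in>carrier G. \<theta> (\<theta> x) = x) \<and>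
     (\<forall>X\<in>lie_algebra G. X \<noteq> 0 \<longrightarrow> - killing G X (push_forward G \<theta> X) > 0)"

definition cartan_p :: "('g, 'e::euclidean_space) lie_struct \<Rightarrow> ('g \<Rightarrow> 'g) \<Rightarrow> 'g vfield set" where
  "cartan_p G \<theta> = {X \<in> lie_algebra G. push_forward G \<theta> X = - X}"

definition borel_subalgebra :: "('g, 'e::euclidean_space) lie_struct \<Rightarrow> ('g vfield \<times> 'g vfield) set \<Rightarrow> bool" where
  "borel_subalgebra G \<bb> \<longleftrightarrow>
     (let sol = (\<lambda>B. B \<subseteq> lie_algebra G \<times> lie_algebra G \<and> cvf.subspace B \<and>
                   (\<forall>Z\<in>B. \<forall>Z'\<in>B. cvbracket Z Z' \<in> B) \<and> solvable cvf.span cvbracket B)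
      in sol \<bb> \<and> (\<forall>B. sol B \<and> \<bb> \<subseteq> B \<longrightarrow> B = \<bb>))"

definition parabolic_subalgebra :: "('g, 'e::euclidean_space) lie_struct \<Rightarrow> 'g vfield set \<Rightarrow> bool" where
  "parabolic_subalgebra G \<qq> \<longleftrightarrow> \<qq> \<subseteq> lie_algebra G \<and> vf.subspace \<qq> \<and>
     (\<forall>X\<in>\<qq>. \<forall>Y\<in>\<qq>. vbracket X Y \<in> \<qq>) \<and> (\<exists>\<bb>. borel_subalgebra G \<bb> \<and> \<bb> \<subseteq> \<qq> \<times> \<qq>)"

text \<open>A parabolic subgroup is the normalizer of a real subalgebra whose complexification contains a Borel
  subalgebra. The whole group counts as parabolic.\<close>
definition parabolic_subgroup :: "('g, 'e::euclidean_space) lie_struct \<Rightarrow> 'g set \<Rightarrow> bool" where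
  "parabolic_subgroup G Q \<longleftrightarrow>
     (\<exists>\<qq>. parabolic_subalgebra G \<qq> \<and> Q = {g \<in> carrier G. Ad G g ` \<qq> = \<qq>})"

section \<open>Hermitian linear algebra on \<open>V\<close>\<close>

text \<open>\<open>V\<close> is \<open>complex ^ 'n\<close>, its endomorphisms are matrices. The scalar product \<open>h\<close> is arbitrary, linear
  in the first argument. Endomorphisms of a subspace \<open>W\<close> are functions on \<open>W\<close>, extended by \<open>undefined\<close>.\<close>

definition hermitian_product :: "(complex ^ 'n \<Rightarrow> complex ^ 'n \<Rightarrow> complex) \<Rightarrow> bool" where
  "hermitian_product h \<longleftrightarrow>
     (\<forall>u v w. h (u + v) w = h u w + h v w) \<and> (\<forall>c v w. h (c *s v) w = c * h v w) \<and>
     (\<forall>v w. h w v = cnj (h v w)) \<and> (\<forall>v. v \<noteq> 0 \<longrightarrow> Re (h v v) > 0)"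

definition hperp :: "(complex ^ 'n \<Rightarrow> complex ^ 'n \<Rightarrow> complex) \<Rightarrow> (complex ^ 'n) set \<Rightarrow> (complex ^ 'n) set" where
  "hperp h W = {v. \<forall>w\<in>W. h v w = 0}"

definition hproj :: "(complex ^ 'n \<Rightarrow> complex ^ 'n \<Rightarrow> complex) \<Rightarrow> (complex ^ 'n) set \<Rightarrow> complex ^ 'n \<Rightarrow> complex ^ 'n" where
  "hproj h W v = (THE w. w \<in> W \<and> v - w \<in> hperp h W)"

definition adj_on :: "(complex ^ 'n \<Rightarrow> complex ^ 'n \<Rightarrow> complex) \<Rightarrow> (complex ^ 'n) set \<Rightarrow>
    (complex ^ 'n \<Rightarrow> complex ^ 'n) \<Rightarrow> (complex ^ 'n \<Rightarrow> complex ^ 'n)" where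
  "adj_on h W f = (\<lambda>w\<in>W. THE u. u \<in> W \<and> (\<forall>v\<in>W. h (f v) w = h v u))"

definition sqrt_on :: "(complex ^ 'n \<Rightarrow> complex ^ 'n \<Rightarrow> complex) \<Rightarrow> (complex ^ 'n) set \<Rightarrow>
    (complex ^ 'n \<Rightarrow> complex ^ 'n) \<Rightarrow> (complex ^ 'n \<Rightarrow> complex ^ 'n)" where
  "sqrt_on h W f = (THE s. s \<in> W \<rightarrow>\<^sub>E W \<and>
     (\<forall>v\<in>W. \<forall>w\<in>W. s (v + w) = s v + s w) \<and> (\<forall>c. \<forall>v\<in>W. s (c *s v) = c *s s v) \<and>
     (\<forall>v\<in>W. \<forall>w\<in>W. h (s v) w = h v (s w)) \<and> (\<forall>v\<in>W. Re (h (s v) v) \<ge> 0) \<and>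
     (\<forall>v\<in>W. s (s v) = f v))"

definition herm_endos :: "(complex ^ 'n \<Rightarrow> complex ^ 'n \<Rightarrow> complex) \<Rightarrow> (complex ^ 'n ^ 'n) set" where
  "herm_endos h = {A. \<forall>v w. h (A *v v) w = h v (A *v w)}"

definition SU :: "(complex ^ 'n \<Rightarrow> complex ^ 'n \<Rightarrow> complex) \<Rightarrow> (complex ^ 'n ^ 'n) set" where
  "SU h = {A. det A = 1 \<and> (\<forall>v w. h (A *v v) (A *v w) = h v w)}"

definition su_alg :: "(complex ^ 'n \<Rightarrow> complex ^ 'n \<Rightarrow> complex) \<Rightarrow> (complex ^ 'n ^ 'n) set" where
  "su_alg h = {A. trace A = 0 \<and> (\<forall>v w. h (A *v v) w = - h v (A *v w))}"

text \<open>The library's \<open>exp\<close> is not available for matrices, whose type-class multiplication is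
  componentwise.\<close>
definition mat_exp :: "complex ^ 'n ^ 'n \<Rightarrow> complex ^ 'n ^ 'n" where
  "mat_exp A = (\<Sum>k. (1 / fact k) *\<^sub>R (((**) A ^^ k) (mat 1)))"

section \<open>Representations and projective spaces\<close>

definition SL :: "(complex ^ 'n ^ 'n) monoid" where
  "SL = \<lparr>carrier = {A. det A = 1}, monoid.mult = (**), one = mat 1\<rparr>"

definition acts_irreducibly :: "(complex ^ 'n ^ 'n) set \<Rightarrow> (complex ^ 'n) set \<Rightarrow> bool" where
  "acts_irreducibly S W \<longleftrightarrow> W \<noteq> {0} \<and> (\<forall>A\<in>S. (*v) A ` W \<subseteq> W) \<and>
     (\<forall>U. vec.subspace U \<and> U \<subseteq> W \<and> (\<forall>A\<in>S. (*v) A ` U \<subseteq> U) \<longrightarrow> U = {0} \<or> U = W)"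

text \<open>The differential at the identity of \<open>\<tau>\<close>, entry by entry.\<close>
definition d_rep :: "('g, 'e::euclidean_space) lie_struct \<Rightarrow> ('g \<Rightarrow> complex ^ 'n ^ 'n) \<Rightarrow> 'g vfield \<Rightarrow> complex ^ 'n ^ 'n" where
  "d_rep G \<tau> X = (\<chi> i j. Complex
      (X (ext_zero G (\<lambda>g. Re (\<tau> g $ i $ j))) \<one>\<^bsub>G\<^esub>) (X (ext_zero G (\<lambda>g. Im (\<tau> g $ i $ j))) \<one>\<^bsub>G\<^esub>))"

text \<open>Compatibility of \<open>\<tau>(G)\<close> with the complexification of \<open>SU(V, h)\<close>; \<open>mat \<i> ** A\<close> is the scalar
  multiple \<open>\<i> A\<close>.\<close>
definition compatible :: "('g, 'e::euclidean_space) lie_struct \<Rightarrow> 'g set \<Rightarrow> ('g \<Rightarrow> 'g) \<Rightarrow>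
    ('g \<Rightarrow> complex ^ 'n ^ 'n) \<Rightarrow> (complex ^ 'n \<Rightarrow> complex ^ 'n \<Rightarrow> complex) \<Rightarrow> bool" where
  "compatible G K \<theta> \<tau> h \<longleftrightarrow> \<tau> ` K \<subseteq> SU h \<and>
     d_rep G \<tau> ` cartan_p G \<theta> \<subseteq> (\<lambda>A. mat \<i> ** A) ` su_alg h \<and>
     \<tau> ` carrier G = {A ** B |A B. A \<in> \<tau> ` K \<and> B \<in> mat_exp ` d_rep G \<tau> ` cartan_p G \<theta>}"

inductive mat_polynomial :: "(complex ^ 'n ^ 'n \<Rightarrow> complex) \<Rightarrow> bool" where
  const: "mat_polynomial (\<lambda>A. c)"
| entry: "mat_polynomial (\<lambda>A. A $ i $ j)"
| add: "mat_polynomial p \<Longrightarrow> mat_polynomial q \<Longrightarrow> mat_polynomial (\<lambda>A. p A + q A)"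
| mult: "mat_polynomial p \<Longrightarrow> mat_polynomial q \<Longrightarrow> mat_polynomial (\<lambda>A. p A * q A)"

definition zariski_closure_SL :: "(complex ^ 'n ^ 'n) set \<Rightarrow> (complex ^ 'n ^ 'n) set" where
  "zariski_closure_SL S = {A. det A = 1 \<and> (\<forall>p. mat_polynomial p \<and> (\<forall>B\<in>S. p B = 0) \<longrightarrow> p A = 0)}"

definition final_topology :: "'a topology \<Rightarrow> ('a \<Rightarrow> 'b) \<Rightarrow> 'b topology" where
  "final_topology T f =
     topology (\<lambda>U. U \<subseteq> f ` topspace T \<and> openin T {x \<in> topspace T. f x \<in> U})"

lemma openin_final_topology:
  "openin (final_topology T f) U \<longleftrightarrow> U \<subseteq> f ` topspace T \<and> openin T {x \<in> topspace T. f x \<in> U}"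
proof -
  have "istopology (\<lambda>U. U \<subseteq> f ` topspace T \<and> openin T {x \<in> topspace T. f x \<in> U})"
    unfolding istopology_def
  proof (intro conjI allI impI)
    fix S S' assume *: "S \<subseteq> f ` topspace T \<and> openin T {x \<in> topspace T. f x \<in> S}"
      "S' \<subseteq> f ` topspace T \<and> openin T {x \<in> topspace T. f x \<in> S'}"
    have "{x \<in> topspace T. f x \<in> S \<inter> S'} = {x \<in> topspace T. f x \<in> S} \<inter> {x \<in> topspace T. f x \<in> S'}"
      by auto
    then show "openin T {x \<in> topspace T. f x \<in> S \<inter> S'}" using * by auto
    show "S \<inter> S' \<subseteq> f ` topspace T" using * by auto
  next
    fix \<K> assume *: "\<forall>S\<in>\<K>. S \<subseteq> f ` topspace T \<and> openin T {x \<in> topspace T. f x \<in> S}"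
    have "{x \<in> topspace T. f x \<in> \<Union>\<K>} = (\<Union>S\<in>\<K>. {x \<in> topspace T. f x \<in> S})" by auto
    then show "openin T {x \<in> topspace T. f x \<in> \<Union>\<K>}" using * by auto
    show "\<Union>\<K> \<subseteq> f ` topspace T" using * by blast
  qed
  then show ?thesis unfolding final_topology_def by (simp add: topology_inverse')
qed

text \<open>Points of a projective space are the lines themselves.\<close>
definition proj_space :: "(complex ^ 'n) set \<Rightarrow> (complex ^ 'n) set set" where
  "proj_space W = {vec.span {v} |v. v \<in> W \<and> v \<noteq> 0}"

definition proj_topology :: "(complex ^ 'n) set topology" where
  "proj_topology = final_topology (top_of_set (UNIV - {0})) (\<lambda>v. vec.span {v})"

text \<open>Here \<open>span\<close> is the real span: \<open>H(V)\<close> is a real vector space.\<close>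
definition herm_proj_topology :: "(complex ^ 'n \<Rightarrow> complex ^ 'n \<Rightarrow> complex) \<Rightarrow> (complex ^ 'n ^ 'n) set topology" where
  "herm_proj_topology h = final_topology (top_of_set (herm_endos h - {0})) (\<lambda>A. span {A})"

definition closed_orbit :: "(complex ^ 'n ^ 'n) set \<Rightarrow> (complex ^ 'n) set set \<Rightarrow> bool" where
  "closed_orbit S Orb \<longleftrightarrow> closedin proj_topology Orb \<and>
     (\<exists>x\<in>proj_space UNIV. Orb = (\<lambda>A. (*v) A ` x) ` S)"

section \<open>\<open>\<tau>\<close>-connected subspaces\<close>

definition Q_of :: "('g, 'e::euclidean_space) lie_struct \<Rightarrow> ('g \<Rightarrow> complex ^ 'n ^ 'n) \<Rightarrow> (complex ^ 'n) set \<Rightarrow> 'g set" where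
  "Q_of G \<tau> W = {g \<in> carrier G. (*v) (\<tau> g) ` W = W}"

definition tau_connected :: "('g, 'e::euclidean_space) lie_struct \<Rightarrow> ('g \<Rightarrow> complex ^ 'n ^ 'n) \<Rightarrow> (complex ^ 'n) set \<Rightarrow> bool" where
  "tau_connected G \<tau> W \<longleftrightarrow> vec.subspace W \<and> W \<noteq> {0} \<and>
     parabolic_subgroup G (Q_of G \<tau> W) \<and> acts_irreducibly (\<tau> ` Q_of G \<tau> W) W"

definition L_of :: "('g, 'e::euclidean_space) lie_struct \<Rightarrow> ('g \<Rightarrow> 'g) \<Rightarrow> ('g \<Rightarrow> complex ^ 'n ^ 'n) \<Rightarrow>
    (complex ^ 'n) set \<Rightarrow> 'g set" where
  "L_of G \<theta> \<tau> W = Q_of G \<tau> W \<inter> \<theta> ` Q_of G \<tau> W"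

definition l_of :: "('g, 'e::euclidean_space) lie_struct \<Rightarrow> ('g \<Rightarrow> 'g) \<Rightarrow> ('g \<Rightarrow> complex ^ 'n ^ 'n) \<Rightarrow>
    (complex ^ 'n) set \<Rightarrow> 'g vfield set" where
  "l_of G \<theta> \<tau> W = lie_of_subgroup G (L_of G \<theta> \<tau> W)"

definition a_of :: "('g, 'e::euclidean_space) lie_struct \<Rightarrow> ('g \<Rightarrow> 'g) \<Rightarrow> ('g \<Rightarrow> complex ^ 'n ^ 'n) \<Rightarrow>
    (complex ^ 'n) set \<Rightarrow> 'g vfield set" where
  "a_of G \<theta> \<tau> W = {X \<in> l_of G \<theta> \<tau> W. \<forall>Y\<in>l_of G \<theta> \<tau> W. vbracket X Y = 0} \<inter> cartan_p G \<theta>"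

definition M_of :: "('g, 'e::euclidean_space) lie_struct \<Rightarrow> 'g set \<Rightarrow> ('g \<Rightarrow> 'g) \<Rightarrow> ('g \<Rightarrow> complex ^ 'n ^ 'n) \<Rightarrow>
    (complex ^ 'n) set \<Rightarrow> 'g set" where
  "M_of G K \<theta> \<tau> W =
     {k \<otimes>\<^bsub>G\<^esub> lie_exp G X |k X. k \<in> K \<inter> L_of G \<theta> \<tau> W \<and>
        X \<in> cartan_p G \<theta> \<inter> l_of G \<theta> \<tau> W \<and> (\<forall>Y\<in>a_of G \<theta> \<tau> W. killing G X Y = 0)}"

section \<open>The Satake compactification and the map \<open>ri\<^sub>\<tau>\<close>\<close>

definition satake_compactification :: "('g, 'e::euclidean_space) lie_struct \<Rightarrow> ('g \<Rightarrow> complex ^ 'n ^ 'n) \<Rightarrow>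
    (complex ^ 'n \<Rightarrow> complex ^ 'n \<Rightarrow> complex) \<Rightarrow> (complex ^ 'n ^ 'n) set set" where
  "satake_compactification G \<tau> h = herm_proj_topology h closure_of
     {span {\<tau> g ** matrix (adj_on h UNIV ((*v) (\<tau> g)))} |g. g \<in> carrier G}"

text \<open>\<open>\<tau>\<^sub>W(g) \<tau>\<^sub>W(g)\<^sup>*\<close> as an endomorphism of \<open>W\<close>.\<close>
definition tau_sq :: "(complex ^ 'n \<Rightarrow> complex ^ 'n \<Rightarrow> complex) \<Rightarrow> ('g \<Rightarrow> complex ^ 'n ^ 'n) \<Rightarrow>
    (complex ^ 'n) set \<Rightarrow> 'g \<Rightarrow> (complex ^ 'n \<Rightarrow> complex ^ 'n)" where
  "tau_sq h \<tau> W g =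
     (let \<tau>\<^sub>W = (\<lambda>w\<in>W. \<tau> g *v w) in (\<lambda>w\<in>W. \<tau>\<^sub>W (adj_on h W \<tau>\<^sub>W w)))"

text \<open>The point \<open>[\<tau>\<^sub>W(g) \<tau>\<^sub>W(g)\<^sup>* \<oplus> 0]\<close>.\<close>
definition satake_point :: "(complex ^ 'n \<Rightarrow> complex ^ 'n \<Rightarrow> complex) \<Rightarrow> ('g \<Rightarrow> complex ^ 'n ^ 'n) \<Rightarrow>
    (complex ^ 'n) set \<Rightarrow> 'g \<Rightarrow> (complex ^ 'n ^ 'n) set" where
  "satake_point h \<tau> W g = span {matrix (\<lambda>v. tau_sq h \<tau> W g (hproj h W v))}"

text \<open>By Satake's theorem the strata exhaust the compactification. The map \<open>ri\<close> below is determined by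
  its values on the strata.\<close>
definition satake_strata :: "('g, 'e::euclidean_space) lie_struct \<Rightarrow> 'g set \<Rightarrow> ('g \<Rightarrow> 'g) \<Rightarrow>
    ('g \<Rightarrow> complex ^ 'n ^ 'n) \<Rightarrow> (complex ^ 'n \<Rightarrow> complex ^ 'n \<Rightarrow> complex) \<Rightarrow> (complex ^ 'n ^ 'n) set set" where
  "satake_strata G K \<theta> \<tau> h =
     {satake_point h \<tau> W g |W g. tau_connected G \<tau> W \<and> g \<in> M_of G K \<theta> \<tau> W}"

text \<open>A rational map of \<open>Orb\<close> is a partial map. For a linear map \<open>F\<close> and a line \<open>x = [v]\<close> not in its
  kernel, \<open>F ` x\<close> is the line \<open>[F v]\<close>.\<close>
definition R_map :: "(complex ^ 'n \<Rightarrow> complex ^ 'n \<Rightarrow> complex) \<Rightarrow> ('g \<Rightarrow> complex ^ 'n ^ 'n) \<Rightarrow>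
    (complex ^ 'n) set set \<Rightarrow> (complex ^ 'n) set \<Rightarrow> 'g \<Rightarrow> ((complex ^ 'n) set \<rightharpoonup> (complex ^ 'n) set)" where
  "R_map h \<tau> Orb W g = (\<lambda>x. if x \<in> Orb - proj_space (hperp h W)
     then Some ((\<lambda>v. sqrt_on h W (tau_sq h \<tau> W g) (hproj h W v)) ` x) else None)"

definition rat_eq :: "('x \<rightharpoonup> 'y) \<Rightarrow> ('x \<rightharpoonup> 'y) \<Rightarrow> bool" where
  "rat_eq R S \<longleftrightarrow> (\<forall>x\<in>dom R \<inter> dom S. R x = S x)"

definition ri :: "('g, 'e::euclidean_space) lie_struct \<Rightarrow> 'g set \<Rightarrow> ('g \<Rightarrow> 'g) \<Rightarrow> ('g \<Rightarrow> complex ^ 'n ^ 'n) \<Rightarrow>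
    (complex ^ 'n \<Rightarrow> complex ^ 'n \<Rightarrow> complex) \<Rightarrow> (complex ^ 'n) set set \<Rightarrow>
    (complex ^ 'n ^ 'n) set \<Rightarrow> ((complex ^ 'n) set \<rightharpoonup> (complex ^ 'n) set)" where
  "ri G K \<theta> \<tau> h Orb p = (THE R. \<exists>W g. tau_connected G \<tau> W \<and> g \<in> M_of G K \<theta> \<tau> W \<and>
     p = satake_point h \<tau> W g \<and> R = R_map h \<tau> Orb W g)"

text \<open>Injectivity, where rational maps are compared by \<open>rat_eq\<close>.\<close>
definition rat_inj_on :: "('p \<Rightarrow> ('x \<rightharpoonup> 'y)) \<Rightarrow> 'p set \<Rightarrow> bool" where
  "rat_inj_on F P \<longleftrightarrow> (\<forall>p\<in>P. \<forall>q\<in>P. rat_eq (F p) (F q) \<longrightarrow> p = q)"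

end

theory Submission
  imports Defs
begin

text \<open>
  Let \<open>A\<close> be the square root of \<open>\<tau>\<^sub>W(g) \<tau>\<^sub>W(g)\<^sup>*\<close> composed with the orthogonal projection to \<open>W\<close>. It is a
  positive endomorphism of the whole space \<open>V\<close> with kernel \<open>W\<^sup>\<bottom>\<close>, its square spans the point of the
  compactification, and it induces the rational map. So the theorem says two things about two such
  endomorphisms \<open>A\<close> and \<open>B\<close>.

  If \<open>A\<^sup>2\<close> and \<open>B\<^sup>2\<close> span the same real line, then \<open>A\<close> is a positive multiple of \<open>B\<close>, because positive
  square roots are unique. Hence \<open>A\<close> and \<open>B\<close> have the same kernel and induce the same partial map on lines, and
  \<open>ri\<close> is well defined (\<open>satake_point_eq_iff\<close>, \<open>R_map_cong\<close>).

  Conversely, suppose that the two rational maps agree where both are defined. Then \<open>A v\<close> and \<open>B v\<close> are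
  parallel for all \<open>v\<close> in the cone over the orbit, since outside the common domain one of them is zero. So
  each such \<open>v\<close> lies in the kernel of \<open>B\<close> or in an eigenspace \<open>{v. A v = r B v}\<close>. The eigenvalues \<open>r\<close> are
  real, and there are only finitely many with an eigenvector outside the kernel of \<open>B\<close>, because such
  eigenvectors are orthogonal for the form of \<open>B\<close> (\<open>finite_pencil_eigenvalues\<close>). Thus the cone is covered by
  finitely many subspaces. But \<open>G\<close> is connected and acts irreducibly, so one of these subspaces is all of \<open>V\<close>
  (\<open>irreducible_not_covered\<close>): a minimal cover is canonical, hence permuted by \<open>G\<close>, hence fixed member by
  member. Since \<open>B\<close> is not zero, \<open>A = r B\<close> for some \<open>r\<close>, which is positive by positivity of \<open>A\<close> and
  \<open>B\<close>, and the two points coincide (\<open>parallel_imp_proportional\<close>).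
\<close>

section \<open>Complex vector spaces\<close>

lemma scaleR_eq_complex_scale: "r *\<^sub>R v = complex_of_real r *s v"
  for v :: "complex ^ 'n"
  by (simp add: vec_eq_iff scaleR_conv_of_real[of _ "_ :: complex"])

lemma scaleR_matrix_vector_mult: "(r *\<^sub>R A) *v v = complex_of_real r *s (A *v v)"
  for A :: "complex ^ 'n ^ 'n"
  by (simp add: vec_eq_iff matrix_vector_mult_def sum_distrib_left mult.assoc
      scaleR_conv_of_real[of _ "_ :: complex"])

lemma vec_linearI:
  assumes "\<And>u v. f (u + v) = f u + f v" "\<And>c v. f (c *s v) = c *s f v"
  shows "Vector_Spaces.linear (*s) (*s) f"
  by (simp add: Vector_Spaces.linear_iff vec.vector_space_axioms assms)

section \<open>Hermitian scalar products\<close>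

locale hermitian_space =
  fixes h :: "complex ^ 'n \<Rightarrow> complex ^ 'n \<Rightarrow> complex"
  assumes hermitian: "hermitian_product h"
begin

lemma h_add_left: "h (u + v) w = h u w + h v w"
  and h_scale_left: "h (c *s v) w = c * h v w"
  and h_cnj: "h w v = cnj (h v w)"
  and h_pos: "v \<noteq> 0 \<Longrightarrow> Re (h v v) > 0"
  using hermitian unfolding hermitian_product_def by blast+

lemma h_add_right: "h w (u + v) = h w u + h w v"
  by (metis h_cnj h_add_left complex_cnj_add)

lemma h_scale_right: "h w (c *s v) = cnj c * h w v"
  by (metis h_cnj h_scale_left complex_cnj_mult)

lemma h_zero [simp]: "h 0 w = 0" "h w 0 = 0"
  using h_scale_left[of 0 0 w] h_scale_right[of w 0 0] by simp_all

lemma h_diff_left: "h (u - v) w = h u w - h v w"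
  using h_add_left[of "u - v" v w] by simp

lemma h_diff_right: "h w (u - v) = h w u - h w v"
  using h_add_right[of w "u - v" v] by simp

lemma h_self_zero_iff [simp]: "h v v = 0 \<longleftrightarrow> v = 0"
  using h_pos[of v] by fastforce

lemma h_self_nonneg: "Re (h v v) \<ge> 0"
  using h_pos[of v] by (cases "v = 0") auto

lemma h_sym_zero: "h v w = 0 \<longleftrightarrow> h w v = 0"
  using h_cnj[of v w] h_cnj[of w v] by auto

lemma subspace_annihilator: "vec.subspace {v. h v w = 0}"
  unfolding vec.subspace_def by (auto simp: h_add_left h_scale_left)

lemma subspace_hperp: "vec.subspace (hperp h W)"
  unfolding vec.subspace_def hperp_def by (auto simp: h_add_left h_scale_left)

lemma span_annihilator:
  assumes "v \<in> vec.span S" and "\<And>s. s \<in> S \<Longrightarrow> h s w = 0"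
  shows "h v w = 0"
  using vec.span_minimal[OF _ subspace_annihilator, of S w] assms by auto

lemma mem_hperp_self: "w \<in> W \<Longrightarrow> w \<in> hperp h W \<Longrightarrow> w = 0"
  unfolding hperp_def by auto

lemma bounded_bilinear_h: "bounded_bilinear h"
proof -
  have "bilinear h"
    unfolding bilinear_def
    by (auto intro!: linearI
        simp: h_add_left h_add_right h_scale_left h_scale_right scaleR_eq_complex_scale scaleR_conv_of_real)
  then show ?thesis by (simp add: bilinear_conv_bounded_bilinear)
qed

text \<open>Gram--Schmidt on a spanning set instead of a basis: when \<open>b\<close> already lies in the span of \<open>B\<close>, the
  vector \<open>b - q\<close> is \<open>0\<close>, and \<open>x / 0 = 0\<close> makes the correction term vanish.\<close>
lemma h_residue_finite_span:
  assumes "finite B"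
  shows "\<exists>w\<in>vec.span B. v - w \<in> hperp h B"
  using assms
proof (induction B arbitrary: v)
  case empty
  then show ?case by (auto simp: hperp_def)
next
  case (insert b B)
  obtain p where p: "p \<in> vec.span B" "v - p \<in> hperp h B" using insert.IH by blast
  obtain q where q: "q \<in> vec.span B" "b - q \<in> hperp h B" using insert.IH by blast
  define c where "c = h (v - p) (b - q) / h (b - q) (b - q)"
  define w where "w = p + c *s (b - q)"
  have B: "h (v - w) s = 0" if "s \<in> B" for s
    using p(2) q(2) that
    by (simp add: w_def hperp_def h_diff_left h_add_left h_scale_left)
  have span_B: "h (v - w) s = 0" if "s \<in> vec.span B" for s
    using span_annihilator[OF that, of "v - w"] B h_sym_zero by blast
  have "h (v - w) (b - q) = 0"
  proof (cases "b - q = 0")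
    case False
    have "h (v - w) (b - q) = h (v - p) (b - q) - c * h (b - q) (b - q)"
      by (simp only: w_def diff_diff_eq[symmetric] h_diff_left[of "v - p"] h_scale_left)
    then show ?thesis using False by (simp add: c_def)
  qed (simp only: h_zero)
  then have "h (v - w) b = 0" using span_B[OF q(1)] by (simp add: h_diff_right)
  moreover have "w \<in> vec.span (insert b B)"
    unfolding w_def
    by (intro vec.span_add vec.span_scale vec.span_diff)
      (use p(1) q(1) vec.span_mono[of B "insert b B"] in \<open>auto intro: vec.span_base\<close>)
  ultimately show ?case using B by (intro bexI[of _ w]) (auto simp: hperp_def)
qed

lemma hproj_exists:
  assumes "vec.subspace W"
  shows "\<exists>!w. w \<in> W \<and> v - w \<in> hperp h W"
proof -
  obtain B where B: "finite B" "vec.span B = W"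
    by (metis assms vec.basis_exists vec.finiteI_independent vec.span_subspace)
  obtain w where w: "w \<in> vec.span B" "v - w \<in> hperp h B" using h_residue_finite_span[OF B(1)] by blast
  have "h (v - w) s = 0" if "s \<in> W" for s
    using span_annihilator[of s B "v - w"] that w(2) B(2) h_sym_zero unfolding hperp_def by blast
  then have w_W: "w \<in> W" "v - w \<in> hperp h W" using w B by (auto simp: hperp_def)
  moreover have "w' = w" if w': "w' \<in> W \<and> v - w' \<in> hperp h W" for w'
  proof -
    have diff_W: "w' - w \<in> W" using w' w_W(1) assms by (simp add: vec.subspace_diff)
    have "(v - w) - (v - w') \<in> hperp h W"
      by (rule vec.subspace_diff[OF subspace_hperp w_W(2) conjunct2[OF w']])
    then have "w' - w \<in> hperp h W" by (simp add: algebra_simps)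
    with diff_W have "w' - w = 0" by (rule mem_hperp_self)
    then show ?thesis by simp
  qed
  ultimately show ?thesis by blast
qed

lemma hproj:
  assumes "vec.subspace W"
  shows hproj_in: "hproj h W v \<in> W" and hproj_residue: "v - hproj h W v \<in> hperp h W"
  using theI'[OF hproj_exists[OF assms, of v]] unfolding hproj_def by blast+

lemma hproj_eqI:
  assumes "vec.subspace W" "w \<in> W" "v - w \<in> hperp h W"
  shows "hproj h W v = w"
  using hproj_exists[OF assms(1), of v] hproj[OF assms(1), of v] assms(2,3) by blast

lemma hproj_self: "vec.subspace W \<Longrightarrow> w \<in> W \<Longrightarrow> hproj h W w = w"
  by (intro hproj_eqI) (auto simp: hperp_def)

lemma hproj_zero_iff: "vec.subspace W \<Longrightarrow> hproj h W v = 0 \<longleftrightarrow> v \<in> hperp h W"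
  by (metis diff_zero hproj_eqI hproj_residue vec.subspace_0)

lemma h_hproj_left: "vec.subspace W \<Longrightarrow> w \<in> W \<Longrightarrow> h (hproj h W v) w = h v w"
  using hproj_residue[of W v] by (auto simp: hperp_def h_diff_left)

lemma h_hproj_right: "vec.subspace W \<Longrightarrow> w \<in> W \<Longrightarrow> h w (hproj h W v) = h w v"
  by (metis h_hproj_left h_cnj)

lemma linear_hproj:
  assumes W: "vec.subspace W"
  shows "Vector_Spaces.linear (*s) (*s) (hproj h W)"
proof (rule vec_linearI)
  fix u v and c :: complex
  have "(u - hproj h W u) + (v - hproj h W v) \<in> hperp h W"
    by (intro vec.subspace_add subspace_hperp hproj_residue W)
  then show "hproj h W (u + v) = hproj h W u + hproj h W v"
    by (intro hproj_eqI W vec.subspace_add hproj_in) (simp add: algebra_simps)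
  have "c *s (v - hproj h W v) \<in> hperp h W"
    by (intro vec.subspace_scale subspace_hperp hproj_residue W)
  then show "hproj h W (c *s v) = c *s hproj h W v"
    by (intro hproj_eqI W vec.subspace_scale hproj_in) (simp add: vec.scale_right_diff_distrib)
qed

lemma double_hperp:
  assumes W: "vec.subspace W" and v: "\<And>u. u \<in> hperp h W \<Longrightarrow> h v u = 0"
  shows "v \<in> W"
proof -
  define r where "r = v - hproj h W v"
  have r: "r \<in> hperp h W" unfolding r_def by (rule hproj_residue[OF W])
  have "h r r = h v r - h (hproj h W v) r" by (simp add: r_def h_diff_left)
  also have "\<dots> = 0" using v[OF r] r hproj_in[OF W, of v] h_sym_zero by (auto simp: hperp_def)
  finally have "r = 0" by simp
  then show ?thesis using hproj_in[OF W, of v] by (simp add: r_def)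
qed

text \<open>A nonzero functional is determined up to scale by its kernel, so a vector \<open>y\<close> orthogonal to the kernel
  represents it after rescaling.\<close>
lemma riesz_representation:
  fixes \<phi> :: "complex ^ 'n \<Rightarrow> complex"
  assumes add: "\<And>u v. \<phi> (u + v) = \<phi> u + \<phi> v" and scale: "\<And>c v. \<phi> (c *s v) = c * \<phi> v"
  shows "\<exists>u. \<forall>v. \<phi> v = h v u"
proof (cases "\<forall>v. \<phi> v = 0")
  case True
  then show ?thesis by (intro exI[of _ 0]) auto
next
  case False
  then obtain z where z: "\<phi> z \<noteq> 0" by blast
  define N where "N = {v. \<phi> v = 0}"
  have diff: "\<phi> (u - v) = \<phi> u - \<phi> v" for u v using add[of "u - v" v] by simp
  have zero: "\<phi> 0 = 0" using scale[of 0 0] by simp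
  have N: "vec.subspace N" unfolding N_def vec.subspace_def by (auto simp: add scale zero)
  define y where "y = z - hproj h N z"
  have y: "y \<in> hperp h N" unfolding y_def by (rule hproj_residue[OF N])
  have \<phi>_y: "\<phi> y \<noteq> 0" using z hproj_in[OF N, of z] by (simp add: y_def diff N_def)
  then have "y \<noteq> 0" using zero by auto
  have "\<phi> v = h v (cnj (\<phi> y / h y y) *s y)" for v
  proof -
    have "v - (\<phi> v / \<phi> y) *s y \<in> N" using \<phi>_y by (simp add: N_def diff scale)
    then have "h (v - (\<phi> v / \<phi> y) *s y) y = 0" using y h_sym_zero unfolding hperp_def by blast
    then show ?thesis using \<phi>_y \<open>y \<noteq> 0\<close> by (simp add: h_diff_left h_scale_left h_scale_right)
  qed
  then show ?thesis by blast
qed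

lemma adj_on:
  fixes T :: "complex ^ 'n \<Rightarrow> complex ^ 'n"
  assumes W: "vec.subspace W"
    and add: "\<And>u v. u \<in> W \<Longrightarrow> v \<in> W \<Longrightarrow> T (u + v) = T u + T v"
    and scale: "\<And>c v. v \<in> W \<Longrightarrow> T (c *s v) = c *s T v" and w: "w \<in> W"
  shows adj_on_in: "adj_on h W T w \<in> W"
    and h_adj_on: "v \<in> W \<Longrightarrow> h (T v) w = h v (adj_on h W T w)"
proof -
  interpret P: Vector_Spaces.linear "(*s)" "(*s)" "hproj h W" by (rule linear_hproj[OF W])
  have "\<exists>u. \<forall>v. h (T (hproj h W v)) w = h v u"
    by (rule riesz_representation)
      (auto simp: P.add P.scale add scale hproj_in[OF W] h_add_left h_scale_left)
  then obtain u where u: "\<And>v. h (T (hproj h W v)) w = h v u" by blast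
  let ?is_adj = "\<lambda>u. u \<in> W \<and> (\<forall>v\<in>W. h (T v) w = h v u)"
  have "?is_adj (hproj h W u)"
    using u hproj_in[OF W] by (auto simp: h_hproj_right[OF W] u[symmetric] hproj_self[OF W])
  moreover have "u1 = u2" if "?is_adj u1" "?is_adj u2" for u1 u2
  proof -
    have "u1 - u2 \<in> W" using that by (simp add: W vec.subspace_diff)
    then have "h (u1 - u2) (u1 - u2) = 0" using that by (simp add: h_diff_right)
    then show ?thesis by simp
  qed
  ultimately have "\<exists>!u. ?is_adj u" by blast
  from theI'[OF this] show "adj_on h W T w \<in> W" "v \<in> W \<Longrightarrow> h (T v) w = h v (adj_on h W T w)"
    using w by (auto simp: adj_on_def)
qed

end

section \<open>Positive endomorphisms and their square roots\<close>

context hermitian_space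
begin

definition self_adjoint :: "(complex ^ 'n \<Rightarrow> complex ^ 'n) \<Rightarrow> bool" where
  "self_adjoint f \<longleftrightarrow> Vector_Spaces.linear (*s) (*s) f \<and> (\<forall>v w. h (f v) w = h v (f w))"

definition positive :: "(complex ^ 'n \<Rightarrow> complex ^ 'n) \<Rightarrow> bool" where
  "positive f \<longleftrightarrow> self_adjoint f \<and> (\<forall>v. Re (h (f v) v) \<ge> 0)"

lemma self_adjoint_linear: "self_adjoint f \<Longrightarrow> Vector_Spaces.linear (*s) (*s) f"
  and self_adjoint_swap: "self_adjoint f \<Longrightarrow> h (f v) w = h v (f w)"
  unfolding self_adjoint_def by auto

text \<open>Additivity and homogeneity follow from the adjoint relation because \<open>h\<close> is nondegenerate.\<close>
lemma self_adjointI: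
  assumes swap: "\<And>v w. h (f v) w = h v (f w)"
  shows "self_adjoint f"
proof -
  have eq: "a = b" if "\<And>w. h a w = h b w" for a b
    using that[of "a - b"] h_diff_left[of a b "a - b"] by simp
  have "Vector_Spaces.linear (*s) (*s) f"
    by (rule vec_linearI; rule eq) (simp_all add: swap h_add_left h_scale_left)
  then show ?thesis using swap by (simp add: self_adjoint_def)
qed

lemma self_adjoint_simps:
  assumes "self_adjoint f"
  shows "f (u + v) = f u + f v" "f (u - v) = f u - f v" "f (c *s v) = c *s f v" "f 0 = 0"
  using self_adjoint_linear[OF assms]
  by (simp_all add: vec.linear_add vec.linear_diff vec.linear_scale vec.linear_0)

lemma positive_self_adjoint: "positive f \<Longrightarrow> self_adjoint f"
  and positive_nonneg: "positive f \<Longrightarrow> Re (h (f v) v) \<ge> 0"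
  unfolding positive_def by auto

lemma self_adjoint_Im: "self_adjoint f \<Longrightarrow> Im (h (f v) v) = 0"
  using h_cnj[of v "f v"] self_adjoint_swap[of f v v]
  by (metis Reals_cnj_iff complex_is_Real_iff)

lemma self_adjoint_scale_real:
  "self_adjoint f \<Longrightarrow> self_adjoint (\<lambda>v. complex_of_real r *s f v)"
  unfolding self_adjoint_def
  by (auto intro!: vec_linearI simp: vec.linear_add vec.linear_scale h_scale_left h_scale_right
      vec.scale_right_distrib vector_smult_assoc mult.commute)

lemma positive_scale: "positive f \<Longrightarrow> r \<ge> 0 \<Longrightarrow> positive (\<lambda>v. complex_of_real r *s f v)"
  unfolding positive_def by (simp add: self_adjoint_scale_real h_scale_left)

text \<open>Equality case of the Cauchy--Schwarz inequality for the semidefinite form \<open>(v, w) \<mapsto> h (f v) w\<close>: along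
  the line \<open>v + t f v\<close> this form takes the value \<open>2 t a + t\<^sup>2 b\<close> with \<open>a = h (f v) (f v)\<close>, which would be
  negative for small negative \<open>t\<close> if \<open>a > 0\<close>.\<close>
lemma isotropic_in_kernel:
  assumes f: "self_adjoint f" and W: "vec.subspace W" "\<And>w. w \<in> W \<Longrightarrow> f w \<in> W"
    and nonneg: "\<And>w. w \<in> W \<Longrightarrow> Re (h (f w) w) \<ge> 0"
    and v: "v \<in> W" "Re (h (f v) v) = 0"
  shows "f v = 0"
proof (rule ccontr)
  assume "f v \<noteq> 0"
  define a where "a = Re (h (f v) (f v))"
  define b where "b = Re (h (f (f v)) (f v))"
  have a: "a > 0" using \<open>f v \<noteq> 0\<close> h_pos by (simp add: a_def)
  have b: "b \<ge> 0" using nonneg W(2)[OF v(1)] by (simp add: b_def)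
  \<comment> \<open>The minimum of \<open>2 t a + t\<^sup>2 b\<close> is at \<open>t = - a / b\<close>; the summand 1 covers the case \<open>b = 0\<close>.\<close>
  define t where "t = - a / (b + 1)"
  have "h (f (f v)) v = h (f v) (f v)" by (rule self_adjoint_swap[OF f])
  then have expand: "Re (h (f (v + complex_of_real t *s f v)) (v + complex_of_real t *s f v))
      = 2 * t * a + t\<^sup>2 * b"
    using v(2)
    by (simp add: self_adjoint_simps[OF f] h_add_left h_add_right h_scale_left h_scale_right
        a_def b_def power2_eq_square algebra_simps)
  have "v + complex_of_real t *s f v \<in> W"
    using W v by (simp add: vec.subspace_add vec.subspace_scale)
  then have "0 \<le> 2 * t * a + t\<^sup>2 * b" using nonneg expand by metis
  moreover have "2 * t * a + t\<^sup>2 * b < 0"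
  proof -
    have "t < 0" using a b by (simp add: t_def divide_neg_pos)
    have "t * (b + 1) = - a" using b by (simp add: t_def)
    then have "t * b = - a - t" by (simp add: algebra_simps)
    have "2 * t * a + t\<^sup>2 * b = t * (2 * a + t * b)"
      by (simp add: power2_eq_square algebra_simps)
    also have "\<dots> = t * (a - t)" using \<open>t * b = - a - t\<close> by simp
    also have "\<dots> < 0" using \<open>t < 0\<close> a by (simp add: mult_neg_pos)
    finally show ?thesis .
  qed
  ultimately show False by simp
qed

lemma positive_isotropic_in_kernel: "positive f \<Longrightarrow> Re (h (f v) v) = 0 \<Longrightarrow> f v = 0"
  by (rule isotropic_in_kernel[where W = UNIV]) (auto simp: positive_def vec.subspace_UNIV)

lemma continuous_on_self_adjoint_form:
  assumes "self_adjoint f"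
  shows "continuous_on S (\<lambda>v. Re (h (f v) v))"
proof -
  have "linear f"
  proof (rule linearI)
    fix r :: real and v
    show "f (r *\<^sub>R v) = r *\<^sub>R f v" by (simp add: scaleR_eq_complex_scale self_adjoint_simps[OF assms])
  qed (simp add: self_adjoint_simps[OF assms])
  then have "continuous_on S f" by (simp add: linear_continuous_on linear_linear)
  then show ?thesis
    by (intro continuous_on_Re bounded_bilinear.continuous_on[OF bounded_bilinear_h] continuous_on_id)
qed

lemma self_adjoint_ident: "self_adjoint (\<lambda>v. v)"
  unfolding self_adjoint_def by (auto intro: vec_linearI)

lemma closed_vec_subspace:
  fixes W :: "(complex ^ 'n) set"
  assumes "vec.subspace W"
  shows "closed W"
proof (rule closed_subspace)
  show "subspace W"
    using assms by (auto intro!: subspaceI simp: scaleR_eq_complex_scale vec.subspace_0 vec.subspace_add vec.subspace_scale)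
qed

text \<open>A maximum point \<open>v\<close> of the Rayleigh quotient \<open>q\<close> on \<open>W\<close> is an eigenvector: \<open>q v - f\<close> is semidefinite on
  \<open>W\<close> and \<open>v\<close> is isotropic for it. The maximum exists because the quotient is invariant under positive
  scaling, so that it may be taken over the compact unit sphere of the ambient Euclidean norm.\<close>
lemma eigenvector_in_invariant_subspace:
  assumes f: "self_adjoint f" and W: "vec.subspace W" "W \<noteq> {0}"
    and inv: "\<And>w. w \<in> W \<Longrightarrow> f w \<in> W"
  shows "\<exists>v\<in>W. \<exists>r::real. v \<noteq> 0 \<and> f v = complex_of_real r *s v"
proof -
  define q where "q v = Re (h (f v) v) / Re (h v v)" for v
  have q_scale: "q (complex_of_real c *s v) = q v" if "c \<noteq> 0" for c v
    using that by (simp add: q_def self_adjoint_simps[OF f] h_scale_left h_scale_right)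
  have compact: "compact (W \<inter> sphere 0 1)"
    using closed_vec_subspace[OF W(1)] by (simp add: closed_Int_compact)
  obtain u where u: "u \<in> W" "u \<noteq> 0" using W vec.subspace_0 by blast
  have unit: "complex_of_real (1 / norm w) *s w \<in> W \<inter> sphere 0 1" if "w \<in> W" "w \<noteq> 0" for w
    using that vec.subspace_scale[OF W(1) that(1), of "complex_of_real (1 / norm w)"]
    by (simp del: of_real_divide add: scaleR_eq_complex_scale[symmetric])
  have "continuous_on (W \<inter> sphere 0 1) q"
    unfolding q_def
  proof (intro continuous_on_divide continuous_on_self_adjoint_form f self_adjoint_ident ballI)
    fix v assume "v \<in> W \<inter> sphere 0 1"
    then have "v \<noteq> 0" by auto
    then show "Re (h v v) \<noteq> 0" using h_pos by fastforce
  qed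
  then obtain v where v: "v \<in> W \<inter> sphere 0 1" "\<And>w. w \<in> W \<inter> sphere 0 1 \<Longrightarrow> q w \<le> q v"
    using continuous_attains_sup[OF compact] unit[OF u] by blast
  then have v_nonzero: "v \<noteq> 0" "v \<in> W" by auto
  have max: "q w \<le> q v" if "w \<in> W" "w \<noteq> 0" for w
    using v(2)[OF unit[OF that]] q_scale[of "1 / norm w" w] that by simp
  define g where "g w = complex_of_real (q v) *s w - f w" for w
  have g: "self_adjoint g"
    unfolding self_adjoint_def g_def
    by (auto intro!: vec_linearI simp: self_adjoint_simps[OF f] h_diff_left h_diff_right
        h_scale_left h_scale_right self_adjoint_swap[OF f] vec.scale_right_distrib
        vec.scale_right_diff_distrib vector_smult_assoc mult.commute)
  have Re_g: "Re (h (g w) w) = q v * Re (h w w) - Re (h (f w) w)" for w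
    by (simp add: g_def h_diff_left h_scale_left)
  have "g v = 0"
  proof (rule isotropic_in_kernel[OF g W(1)])
    show "g w \<in> W" if "w \<in> W" for w
      using that inv W(1) by (simp add: g_def vec.subspace_diff vec.subspace_scale)
    show "Re (h (g w) w) \<ge> 0" if "w \<in> W" for w
    proof (cases "w = 0")
      case False
      have "Re (h (f w) w) \<le> q v * Re (h w w)"
        using max[OF that False] h_pos[OF False] by (simp add: q_def pos_divide_le_eq)
      then show ?thesis by (simp add: Re_g)
    qed simp
    show "Re (h (g v) v) = 0" using h_pos[OF v_nonzero(1)] by (simp add: Re_g q_def)
  qed (rule v_nonzero)
  then have "f v = complex_of_real (q v) *s v" by (simp add: g_def)
  then show ?thesis using v_nonzero by blast
qed

definition eigenvectors :: "(complex ^ 'n \<Rightarrow> complex ^ 'n) \<Rightarrow> (complex ^ 'n) set" where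
  "eigenvectors f = {v. \<exists>r::real. f v = complex_of_real r *s v}"

text \<open>The spectral theorem in the weak form used here: the orthogonal complement of the span of the
  eigenvectors is invariant, so if it were nonzero it would contain an eigenvector.\<close>
lemma span_eigenvectors:
  assumes f: "self_adjoint f"
  shows "vec.span (eigenvectors f) = UNIV"
proof -
  define E where "E = vec.span (eigenvectors f)"
  have E: "vec.subspace E" by (simp add: E_def)
  have inv: "f w \<in> hperp h E" if w: "w \<in> hperp h E" for w
  proof -
    have "h e (f w) = 0" if e: "e \<in> E" for e
    proof (rule span_annihilator[OF e[unfolded E_def]])
      fix u assume u: "u \<in> eigenvectors f"
      then obtain r where "f u = complex_of_real r *s u" unfolding eigenvectors_def by blast
      then have "h u (f w) = complex_of_real r * h u w"
        using self_adjoint_swap[OF f, of u w] by (simp add: h_scale_left)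
      moreover have "h w u = 0" using w u by (simp add: hperp_def E_def vec.span_base)
      ultimately show "h u (f w) = 0" by (simp add: h_sym_zero)
    qed
    then show ?thesis using h_sym_zero unfolding hperp_def by blast
  qed
  have "hperp h E = {0}"
  proof (rule ccontr)
    assume "hperp h E \<noteq> {0}"
    from eigenvector_in_invariant_subspace[OF f subspace_hperp this inv]
    obtain v where "v \<in> hperp h E" "v \<noteq> 0" "v \<in> eigenvectors f"
      unfolding eigenvectors_def by blast
    then show False using mem_hperp_self[of v E] by (simp add: E_def vec.span_base)
  qed
  then have "v \<in> E" for v using hproj_residue[OF E, of v] hproj_in[OF E, of v] by auto
  then show ?thesis by (auto simp: E_def)
qed

lemma positive_eigenvalue_nonneg:
  assumes "positive f" "v \<noteq> 0" "f v = complex_of_real r *s v"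
  shows "r \<ge> 0"
  using positive_nonneg[OF assms(1), of v] h_pos[OF assms(2)] assms(3)
  by (simp add: h_scale_left zero_le_mult_iff)

text \<open>On an eigenvector \<open>u\<close> of \<open>s\<close> with eigenvalue \<open>r\<close> we have \<open>(t + r) (t - r) u = 0\<close>. For \<open>r > 0\<close> the factor
  \<open>t + r\<close> is injective because \<open>t\<close> has no negative eigenvalue; for \<open>r = 0\<close> the equation \<open>t\<^sup>2 u = 0\<close>
  already forces \<open>t u = 0\<close>.\<close>
lemma positive_sqrt_unique:
  assumes s: "positive s" and t: "positive t" and eq: "\<And>v. s (s v) = t (t v)"
  shows "s = t"
proof -
  note s_simps = self_adjoint_simps[OF positive_self_adjoint[OF s]]
  note t_simps = self_adjoint_simps[OF positive_self_adjoint[OF t]]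
  have on_eigenvectors: "s u = t u" if u: "u \<in> eigenvectors s" for u
  proof (cases "u = 0")
    case False
    obtain r where r: "s u = complex_of_real r *s u" using u unfolding eigenvectors_def by blast
    have r_nonneg: "r \<ge> 0" by (rule positive_eigenvalue_nonneg[OF s False r])
    define d where "d = t u - complex_of_real r *s u"
    have "t d = t (t u) - complex_of_real r *s t u" by (simp add: d_def t_simps)
    also have "\<dots> = complex_of_real (- r) *s d"
      using eq[of u] by (simp add: d_def r s_simps vec.scale_right_diff_distrib)
    finally have t_d: "t d = complex_of_real (- r) *s d" .
    have "d = 0"
    proof (cases "r = 0")
      case True
      then have "h (t u) (t u) = 0"
        using self_adjoint_swap[OF positive_self_adjoint[OF t], of u "t u"] eq[of u] r by (simp add: s_simps)
      then show ?thesis using True by (simp add: d_def)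
    next
      case False
      then show ?thesis using positive_eigenvalue_nonneg[OF t _ t_d] r_nonneg by fastforce
    qed
    then show ?thesis by (simp add: d_def r)
  qed (simp add: s_simps t_simps)
  show ?thesis
  proof
    fix v
    show "s v = t v"
      by (rule vec.linear_eq_on[where B = "eigenvectors s"])
        (use on_eigenvectors s t span_eigenvectors[OF positive_self_adjoint[OF s]] in
          \<open>auto intro: self_adjoint_linear positive_self_adjoint\<close>)
  qed
qed

lemma self_adjoint_on_spanning_set:
  assumes f: "Vector_Spaces.linear (*s) (*s) f" and B: "vec.span B = UNIV"
    and swap: "\<And>b b'. b \<in> B \<Longrightarrow> b' \<in> B \<Longrightarrow> h (f b) b' = h b (f b')"
  shows "self_adjoint f"
proof -
  note f_simps = vec.linear_add[OF f] vec.linear_scale[OF f] vec.linear_0[OF f]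
  have left: "h (f b) w = h b (f w)" if b: "b \<in> B" for b w
  proof -
    have "vec.subspace {w. h (f b) w = h b (f w)}"
      unfolding vec.subspace_def by (auto simp: h_add_right h_scale_right f_simps)
    then have "vec.span B \<subseteq> {w. h (f b) w = h b (f w)}"
      using swap[OF b] by (intro vec.span_minimal) auto
    then show ?thesis using B by auto
  qed
  have "h (f v) w = h v (f w)" for v w
  proof -
    have "vec.subspace {v. h (f v) w = h v (f w)}"
      unfolding vec.subspace_def by (auto simp: h_add_left h_scale_left f_simps)
    then have "vec.span B \<subseteq> {v. h (f v) w = h v (f w)}"
      using left by (intro vec.span_minimal) auto
    then show ?thesis using B by auto
  qed
  then show ?thesis using f by (simp add: self_adjoint_def)
qed

lemma eigenvectors_orthogonal:
  assumes "self_adjoint f" "f u = complex_of_real r *s u" "f v = complex_of_real r' *s v" "r \<noteq> r'"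
  shows "h u v = 0"
proof -
  have "complex_of_real r * h u v = complex_of_real r' * h u v"
    using self_adjoint_swap[OF assms(1), of u v] by (simp add: assms(2,3) h_scale_left h_scale_right)
  then show ?thesis using assms(4) by simp
qed

text \<open>Taking roots of the eigenvalues on a basis of eigenvectors gives a self-adjoint map although the basis
  need not be orthogonal: basis vectors with different eigenvalues are orthogonal, and for equal
  eigenvalues self-adjointness on the pair is trivial.\<close>
lemma positive_sqrt_exists:
  assumes f: "positive f"
  shows "\<exists>s. positive s \<and> (\<forall>v. s (s v) = f v)"
proof -
  note f_sa = positive_self_adjoint[OF f]
  obtain B where B: "B \<subseteq> eigenvectors f" "vec.independent B" "eigenvectors f \<subseteq> vec.span B"
    using vec.maximal_independent_subset[of "eigenvectors f"] by blast
  have span_B: "vec.span B = UNIV"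
    using vec.span_minimal[OF B(3) vec.subspace_span] span_eigenvectors[OF f_sa] by blast
  define ev where "ev b = (SOME r::real. f b = complex_of_real r *s b)" for b
  have ev: "f b = complex_of_real (ev b) *s b" if "b \<in> B" for b
    using that B(1) unfolding eigenvectors_def ev_def by (metis (mono_tags, lifting) mem_Collect_eq someI subsetD)
  have ev_nonneg: "ev b \<ge> 0" if "b \<in> B" for b
  proof (rule positive_eigenvalue_nonneg[OF f _ ev[OF that]])
    show "b \<noteq> 0" using that B(2) vec.dependent_zero by metis
  qed
  \<comment> \<open>Fourth roots are taken because the square of a self-adjoint map is positive, whatever the basis.\<close>
  define t where "t = vec.construct B (\<lambda>b. complex_of_real (sqrt (sqrt (ev b))) *s b)"
  have t_lin: "Vector_Spaces.linear (*s) (*s) t"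
    unfolding t_def by (rule vec.linear_construct[OF B(2)])
  have t_B: "t b = complex_of_real (sqrt (sqrt (ev b))) *s b" if "b \<in> B" for b
    unfolding t_def by (rule vec.construct_basis[OF B(2) that])
  have t: "self_adjoint t"
  proof (rule self_adjoint_on_spanning_set[OF t_lin span_B])
    fix b b' assume b: "b \<in> B" "b' \<in> B"
    show "h (t b) b' = h b (t b')"
    proof (cases "ev b = ev b'")
      case True
      then show ?thesis using b by (simp add: t_B h_scale_left h_scale_right)
    next
      case False
      then have "h b b' = 0" using eigenvectors_orthogonal[OF f_sa ev ev] b by blast
      then show ?thesis using b by (simp add: t_B h_scale_left h_scale_right)
    qed
  qed
  note t_simps = self_adjoint_simps[OF t]
  define s where "s = (\<lambda>v. t (t v))"
  have s_lin: "Vector_Spaces.linear (*s) (*s) s" by (rule vec_linearI) (simp_all add: s_def t_simps)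
  have "h (s v) w = h v (s w)" for v w by (simp add: s_def self_adjoint_swap[OF t])
  moreover have "Re (h (s v) v) \<ge> 0" for v
    using h_self_nonneg[of "t v"] self_adjoint_swap[OF t, of "t v" v] by (simp add: s_def)
  ultimately have "positive s" using s_lin by (simp add: positive_def self_adjoint_def)
  have "s (s v) = f v" for v
  proof (rule vec.linear_eq_on[where B = B and f = "\<lambda>v. s (s v)" and g = f])
    show "Vector_Spaces.linear (*s) (*s) (\<lambda>v. s (s v))"
      by (rule vec_linearI) (simp_all add: s_def t_simps)
    show "s (s b) = f b" if b: "b \<in> B" for b
    proof -
      have "s b = complex_of_real (sqrt (ev b)) *s b"
        using ev_nonneg[OF b] b
        by (simp add: s_def t_B t_simps vector_smult_assoc of_real_mult[symmetric] del: of_real_mult)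
      then show ?thesis
        using ev_nonneg[OF b] b
        by (simp add: self_adjoint_simps[OF positive_self_adjoint[OF \<open>positive s\<close>]] ev
            vector_smult_assoc of_real_mult[symmetric] del: of_real_mult)
    qed
  qed (use span_B self_adjoint_linear[OF f_sa] in auto)
  with \<open>positive s\<close> show ?thesis by blast
qed

end

section \<open>Proportionality of positive endomorphisms\<close>

context hermitian_space
begin

text \<open>Eigenvectors of the pencil \<open>A - r B\<close> for different \<open>r\<close> are orthogonal for the form
  \<open>(v, w) \<mapsto> h v (B w)\<close> and, lying outside the kernel of \<open>B\<close>, not isotropic for it. Hence they are
  linearly independent.\<close>
lemma finite_pencil_eigenvalues:
  assumes A: "self_adjoint A" and B: "positive B"
  shows "finite {r::real. \<exists>v. A v = complex_of_real r *s B v \<and> B v \<noteq> 0}" (is "finite ?R")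
proof -
  note B_sa = positive_self_adjoint[OF B]
  define u where "u r = (SOME v. A v = complex_of_real r *s B v \<and> B v \<noteq> 0)" for r
  have u: "A (u r) = complex_of_real r *s B (u r)" "B (u r) \<noteq> 0" if "r \<in> ?R" for r
    using that someI_ex[of "\<lambda>v. A v = complex_of_real r *s B v \<and> B v \<noteq> 0"] unfolding u_def by auto
  have orthogonal: "h (u r) (B (u r')) = 0" if "r \<in> ?R" "r' \<in> ?R" "r \<noteq> r'" for r r'
  proof -
    have "complex_of_real r * h (u r) (B (u r')) = complex_of_real r' * h (u r) (B (u r'))"
      using self_adjoint_swap[OF A, of "u r" "u r'"] self_adjoint_swap[OF B_sa, of "u r" "u r'"] that
      by (simp add: u h_scale_left h_scale_right)
    then show ?thesis using that(3) by simp
  qed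
  have anisotropic: "h (u r) (B (u r)) \<noteq> 0" if "r \<in> ?R" for r
    using positive_isotropic_in_kernel[OF B, of "u r"] u(2)[OF that] self_adjoint_swap[OF B_sa, of "u r" "u r"]
    by auto
  have "inj_on u ?R"
  proof (rule inj_onI, rule ccontr)
    fix r r' assume "r \<in> ?R" "r' \<in> ?R" "u r = u r'" "r \<noteq> r'"
    then show False using orthogonal[of r r'] anisotropic[of r'] by simp
  qed
  have "vec.independent (u ` ?R)"
    unfolding vec.dependent_def
  proof
    assume "\<exists>a\<in>u ` ?R. a \<in> vec.span (u ` ?R - {a})"
    then obtain r where r: "r \<in> ?R" "u r \<in> vec.span (u ` ?R - {u r})" by blast
    have "h s (B (u r)) = 0" if "s \<in> u ` ?R - {u r}" for s
      using that orthogonal r(1) by blast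
    then have "h (u r) (B (u r)) = 0" by (rule span_annihilator[OF r(2)])
    then show False using anisotropic[OF r(1)] by simp
  qed
  then show ?thesis
    using \<open>inj_on u ?R\<close> finite_imageD vec.finiteI_independent by blast
qed

lemma pencil_eigenvalue_real:
  assumes A: "self_adjoint A" and B: "positive B" and v: "A v = c *s B v" "B v \<noteq> 0"
  shows "c = complex_of_real (Re c)"
proof -
  have "Re (h (B v) v) \<noteq> 0" using positive_isotropic_in_kernel[OF B] v(2) by blast
  moreover have "Im (c * h (B v) v) = 0"
    using self_adjoint_Im[OF A, of v] v(1) by (simp add: h_scale_left)
  ultimately have "Im c = 0" using self_adjoint_Im[OF positive_self_adjoint[OF B], of v] by simp
  then show ?thesis by (simp add: complex_eq_iff)
qed

text \<open>The algebraic core of injectivity. If \<open>A v\<close> and \<open>B v\<close> are parallel for every \<open>v\<close> in \<open>C\<close>, then \<open>C\<close> is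
  covered by the kernel of \<open>B\<close> and the eigenspaces of the pencil \<open>A - r B\<close>. There are only finitely many
  of these, so a set \<open>C\<close> that is not covered by finitely many proper subspaces leaves only the possibility
  that one eigenspace is everything.\<close>
lemma parallel_imp_proportional:
  assumes A: "positive A" and B: "positive B" and nonzero: "A a \<noteq> 0" "B b \<noteq> 0"
    and thick: "\<And>F. finite F \<Longrightarrow> (\<And>U. U \<in> F \<Longrightarrow> vec.subspace U) \<Longrightarrow> C \<subseteq> \<Union>F \<Longrightarrow> UNIV \<in> F"
    and parallel: "\<And>v. v \<in> C \<Longrightarrow> B v \<noteq> 0 \<Longrightarrow> \<exists>c. A v = c *s B v"
  shows "\<exists>r>0. \<forall>v. A v = complex_of_real r *s B v"
proof -
  note A_sa = positive_self_adjoint[OF A] and B_sa = positive_self_adjoint[OF B]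
  define R where "R = {r::real. \<exists>v. A v = complex_of_real r *s B v \<and> B v \<noteq> 0}"
  define E where "E r = {v. A v = complex_of_real r *s B v}" for r :: real
  define N where "N = {v. B v = 0}"
  have "UNIV \<in> insert N (E ` R)"
  proof (rule thick)
    show "finite (insert N (E ` R))" using finite_pencil_eigenvalues[OF A_sa B] by (simp add: R_def)
    show "vec.subspace U" if "U \<in> insert N (E ` R)" for U
      using that unfolding vec.subspace_def N_def E_def
      by (auto simp: self_adjoint_simps[OF A_sa] self_adjoint_simps[OF B_sa]
          vec.scale_right_distrib vector_smult_assoc mult.commute)
    show "C \<subseteq> \<Union>(insert N (E ` R))"
    proof
      fix v assume v: "v \<in> C"
      show "v \<in> \<Union>(insert N (E ` R))"
      proof (cases "B v = 0")
        case False
        then obtain c where c: "A v = c *s B v" using parallel v by blast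
        then have "A v = complex_of_real (Re c) *s B v"
          using pencil_eigenvalue_real[OF A_sa B c False] by simp
        then have "v \<in> E (Re c)" "Re c \<in> R" using False by (auto simp: E_def R_def)
        then show ?thesis by blast
      qed (simp add: N_def)
    qed
  qed
  then obtain r where "E r = UNIV" using nonzero(2) by (auto simp: N_def)
  then have r: "A v = complex_of_real r *s B v" for v by (auto simp: E_def)
  have "Re (h (A a) a) \<noteq> 0" using positive_isotropic_in_kernel[OF A] nonzero(1) by blast
  then have "r * Re (h (B a) a) > 0"
    using positive_nonneg[OF A, of a] r[of a] by (simp add: h_scale_left order_less_le)
  then have "r > 0" using positive_nonneg[OF B, of a] by (simp add: zero_less_mult_iff)
  with r show ?thesis by blast
qed

end

section \<open>Orbits of connected irreducible groups are not covered by finitely many subspaces\<close>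

text \<open>Among the finite covers of \<open>C\<close> by subspaces take one whose largest dimension \<open>d\<close> is minimal, and
  among these one with the fewest members of dimension \<open>d\<close>. Its set \<open>T\<close> of members of dimension \<open>d\<close>
  is contained in every other cover of this dimension, because intersecting the two covers yields a
  third one. So \<open>T\<close> is canonical, and every linear automorphism that preserves \<open>C\<close> permutes it.\<close>
lemma minimal_subspace_cover:
  fixes C :: "(complex ^ 'n) set" and F\<^sub>0 :: "(complex ^ 'n) set set"
  defines "cover d F \<equiv> finite F \<and> (\<forall>U\<in>F. vec.subspace U \<and> vec.dim U \<le> d) \<and> C \<subseteq> \<Union>F"
  assumes C: "v \<in> C" "v \<noteq> 0" and F\<^sub>0: "cover d\<^sub>0 F\<^sub>0"
  obtains d T where "finite T" "T \<noteq> {}" "0 < d" "d \<le> d\<^sub>0"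
    "\<And>U. U \<in> T \<Longrightarrow> vec.subspace U \<and> vec.dim U = d"
    "\<And>A. (*v) A ` C = C \<Longrightarrow> inj ((*v) A) \<Longrightarrow> (\<lambda>U. (*v) A ` U) ` T = T"
proof -
  define d where "d = (LEAST d. \<exists>F. cover d F)"
  have "\<exists>F. cover d F" unfolding d_def by (rule LeastI[of "\<lambda>d. \<exists>F. cover d F"]) (use F\<^sub>0 in blast)
  then obtain F where F: "cover d F"
    and F_min: "\<And>F'. cover d F' \<Longrightarrow> card {U\<in>F. vec.dim U = d} \<le> card {U\<in>F'. vec.dim U = d}"
    using ex_has_least_nat[of "cover d" _ "\<lambda>F. card {U\<in>F. vec.dim U = d}"] by blast
  define T where "T = {U\<in>F. vec.dim U = d}"
  have "d \<le> d\<^sub>0" unfolding d_def by (rule Least_le) (use F\<^sub>0 in blast)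
  have "d \<noteq> 0"
  proof
    assume "d = 0"
    then obtain U where "v \<in> U" "vec.subspace U" "vec.dim U = 0" using F C(1) unfolding cover_def by blast
    then show False using C(2) vec.dim_eq_0 by (metis empty_iff singletonD subsetD)
  qed
  have "T \<noteq> {}"
  proof
    assume "T = {}"
    then have "cover (d - 1) F" using F unfolding cover_def T_def by fastforce
    then have "d \<le> d - 1" unfolding d_def by (intro Least_le) blast
    then show False using \<open>d \<noteq> 0\<close> by simp
  qed
  have T_sub: "T \<subseteq> F'" if F': "cover d F'" for F'
  proof -
    define I where "I = (\<lambda>(U, U'). U \<inter> U') ` (F \<times> F')"
    have "cover d I"
      unfolding cover_def
    proof (intro conjI ballI)
      show "finite I" using F F' by (simp add: I_def cover_def)
      show "C \<subseteq> \<Union>I"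
      proof
        fix x assume "x \<in> C"
        then obtain U U' where "x \<in> U" "U \<in> F" "x \<in> U'" "U' \<in> F'"
          using F F' unfolding cover_def by blast
        then show "x \<in> \<Union>I" unfolding I_def by blast
      qed
      fix V assume "V \<in> I"
      then obtain U U' where V: "V = U \<inter> U'" "U \<in> F" "U' \<in> F'" unfolding I_def by auto
      then show "vec.subspace V" using F F' by (simp add: cover_def vec.subspace_inter)
      have "vec.dim V \<le> vec.dim U" using V by (intro vec.dim_subset) blast
      then show "vec.dim V \<le> d" using F V(2) unfolding cover_def by fastforce
    qed
    then have "card T \<le> card {V\<in>I. vec.dim V = d}" unfolding T_def by (rule F_min)
    moreover have "{V\<in>I. vec.dim V = d} \<subseteq> T \<inter> F'"
    proof
      fix V assume "V \<in> {V\<in>I. vec.dim V = d}"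
      then obtain U U' where V: "V = U \<inter> U'" "U \<in> F" "U' \<in> F'" "vec.dim V = d"
        unfolding I_def by auto
      have sub: "vec.subspace U" "vec.dim U \<le> d" "vec.subspace U'" "vec.dim U' \<le> d"
        using F F' V(2,3) unfolding cover_def by auto
      then have "vec.subspace V" using V(1) by (simp add: vec.subspace_inter)
      then have "V = U" "V = U'"
        using V(1,4) sub vec.subspace_dim_equal[of V U] vec.subspace_dim_equal[of V U'] by auto
      then show "V \<in> T \<inter> F'" using V by (simp add: T_def)
    qed
    moreover have "finite T" using F by (simp add: T_def cover_def)
    ultimately have "card T \<le> card (T \<inter> F')"
      using card_mono[of "T \<inter> F'" "{V\<in>I. vec.dim V = d}"] by force
    then have "T \<inter> F' = T" using \<open>finite T\<close> by (intro card_seteq) auto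
    then show ?thesis by blast
  qed
  have invariant: "(\<lambda>U. (*v) A ` U) ` T = T" if A: "(*v) A ` C = C" "inj ((*v) A)" for A
  proof -
    have dim_A: "vec.dim ((*v) A ` U) = vec.dim U" for U
      by (rule vec.dim_image_eq[OF matrix_vector_mul_linear_gen inj_on_subset[OF A(2) subset_UNIV]])
    have "cover d ((\<lambda>U. (*v) A ` U) ` F)"
      unfolding cover_def
    proof (intro conjI)
      show "C \<subseteq> \<Union>((\<lambda>U. (*v) A ` U) ` F)"
      proof
        fix x assume "x \<in> C"
        then obtain y where y: "y \<in> C" "x = A *v y" using A(1) by (metis imageE)
        then obtain U where "U \<in> F" "y \<in> U" using F unfolding cover_def by blast
        then show "x \<in> \<Union>((\<lambda>U. (*v) A ` U) ` F)" using y(2) by blast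
      qed
      show "\<forall>V\<in>(\<lambda>U. (*v) A ` U) ` F. vec.subspace V \<and> vec.dim V \<le> d"
        using F vec.linear_subspace_image[OF matrix_vector_mul_linear_gen, of _ A]
        by (simp add: cover_def dim_A)
    qed (use F in \<open>simp add: cover_def\<close>)
    then have "T \<subseteq> (\<lambda>U. (*v) A ` U) ` F" by (rule T_sub)
    have "T \<subseteq> (\<lambda>U. (*v) A ` U) ` T"
    proof
      fix V assume V: "V \<in> T"
      then obtain U where U: "U \<in> F" "V = (*v) A ` U"
        using \<open>T \<subseteq> (\<lambda>U. (*v) A ` U) ` F\<close> by auto
      then have "U \<in> T" using V dim_A[of U] by (simp add: T_def)
      then show "V \<in> (\<lambda>U. (*v) A ` U) ` T" using U(2) by simp
    qed
    moreover have "finite T" using F by (simp add: T_def cover_def)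
    ultimately show ?thesis
      using card_seteq[of "(\<lambda>U. (*v) A ` U) ` T" T, symmetric]
        card_image_le[of T "\<lambda>U. (*v) A ` U"] by simp
  qed
  show thesis
    by (rule that[of T d]) (use F \<open>T \<noteq> {}\<close> \<open>d \<noteq> 0\<close> \<open>d \<le> d\<^sub>0\<close> invariant in \<open>auto simp: T_def cover_def\<close>)
qed

lemma closed_matrices_mapping_into:
  fixes U U' :: "(complex ^ 'n) set"
  assumes "vec.subspace U'"
  shows "closed {A :: complex ^ 'n ^ 'n. (*v) A ` U \<subseteq> U'}"
proof (rule closed_subspace)
  show "subspace {A :: complex ^ 'n ^ 'n. (*v) A ` U \<subseteq> U'}"
    using assms
    by (auto intro!: subspaceI simp: image_subset_iff matrix_vector_mult_add_rdistrib
        scaleR_matrix_vector_mult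
        vec.subspace_0 vec.subspace_add vec.subspace_scale)
qed

text \<open>The action permutes the finite set \<open>T\<close> of subspaces from \<open>minimal_subspace_cover\<close>. The
  transporters from one member to the members of \<open>T\<close> are closed and partition the connected space \<open>X\<close>, so each member of \<open>T\<close> is invariant.
  By irreducibility it is the whole space, which is impossible in a cover by proper subspaces.\<close>
lemma irreducible_not_covered:
  fixes X :: "'g topology" and \<tau> :: "'g \<Rightarrow> complex ^ 'n ^ 'n"
  assumes X: "connected_space X" and cont: "continuous_map X euclidean \<tau>"
    and e: "e \<in> topspace X" "\<tau> e = mat 1"
    and inj: "\<And>g. g \<in> topspace X \<Longrightarrow> inj ((*v) (\<tau> g))"
    and irreducible: "acts_irreducibly (\<tau> ` topspace X) UNIV"
    and C: "\<And>g. g \<in> topspace X \<Longrightarrow> (*v) (\<tau> g) ` C = C" "v \<in> C" "v \<noteq> 0"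
    and F: "finite F" "\<And>U. U \<in> F \<Longrightarrow> vec.subspace U" "C \<subseteq> \<Union>F"
  shows "UNIV \<in> F"
proof (rule ccontr)
  assume "UNIV \<notin> F"
  define n where "n = vec.dim (UNIV :: (complex ^ 'n) set)"
  have proper: "vec.dim U \<le> n - 1" if "U \<in> F" for U
  proof -
    have "vec.dim U \<noteq> n"
      using that F(2) \<open>UNIV \<notin> F\<close> vec.subspace_dim_equal[of U UNIV] by (auto simp: n_def)
    moreover have "vec.dim U \<le> n" unfolding n_def by (rule vec.dim_subset) simp
    ultimately show ?thesis by simp
  qed
  obtain d T where T: "finite T" "T \<noteq> {}" "0 < d" "d \<le> n - 1"
    and T_sub: "\<And>U. U \<in> T \<Longrightarrow> vec.subspace U \<and> vec.dim U = d"
    and T_inv: "\<And>A. (*v) A ` C = C \<Longrightarrow> inj ((*v) A) \<Longrightarrow> (\<lambda>U. (*v) A ` U) ` T = T"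
    using minimal_subspace_cover[OF C(2,3), of F "n - 1"] F proper by metis
  obtain U where U: "U \<in> T" using T(2) by blast
  define Z where "Z U' = {g \<in> topspace X. (*v) (\<tau> g) ` U \<subseteq> U'}" for U'
  have image: "(*v) (\<tau> g) ` U = U'" if "U' \<in> T" "g \<in> Z U'" for U' g
  proof (rule vec.subspace_dim_equal)
    show "vec.dim U' \<le> vec.dim ((*v) (\<tau> g) ` U)"
      using inj[of g] that U T_sub
        vec.dim_image_eq[OF matrix_vector_mul_linear_gen inj_on_subset[OF _ subset_UNIV], of "\<tau> g" U]
      by (simp add: Z_def)
  qed (use that U T_sub in \<open>auto simp: Z_def intro!: vec.linear_subspace_image\<close>)
  have closed: "closedin X (Z U')" if "U' \<in> T" for U'
    using closedin_continuous_map_preimage[OF cont, of "{A. (*v) A ` U \<subseteq> U'}"]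
      closed_matrices_mapping_into[of U' U] T_sub[OF that] by (simp add: Z_def)
  have "closedin X (\<Union>U'\<in>T - {U}. Z U')" using T(1) closed by (intro closedin_Union) auto
  moreover have "topspace X \<subseteq> Z U \<union> (\<Union>U'\<in>T - {U}. Z U')"
  proof
    fix g assume g: "g \<in> topspace X"
    then have "(*v) (\<tau> g) ` U \<in> T" using T_inv[OF C(1) inj] U by blast
    then show "g \<in> Z U \<union> (\<Union>U'\<in>T - {U}. Z U')" using g by (auto simp: Z_def)
  qed
  moreover have "Z U \<inter> (\<Union>U'\<in>T - {U}. Z U') = {}" using image U by blast
  moreover have "e \<in> Z U" using e by (auto simp: Z_def)
  ultimately have "(\<Union>U'\<in>T - {U}. Z U') = {}"
    using X closed[OF U] unfolding connected_space_closedin by blast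
  with \<open>topspace X \<subseteq> Z U \<union> (\<Union>U'\<in>T - {U}. Z U')\<close>
  have "\<forall>A\<in>\<tau> ` topspace X. (*v) A ` U \<subseteq> U" by (auto simp: Z_def)
  then have "U = {0} \<or> U = UNIV"
    using irreducible T_sub[OF U] unfolding acts_irreducibly_def by blast
  then show False using T_sub[OF U] T(3,4) by (auto simp: n_def)
qed

section \<open>The positive endomorphisms attached to boundary points\<close>

text \<open>\<open>\<tau>\<^sub>W(g) \<tau>\<^sub>W(g)\<^sup>* \<oplus> 0\<close> and its square root, as endomorphisms of the whole space: points of different
  strata can be compared only after extension by zero on \<open>W\<^sup>\<bottom>\<close>.\<close>
definition square_endo :: "(complex ^ 'n \<Rightarrow> complex ^ 'n \<Rightarrow> complex) \<Rightarrow> ('g \<Rightarrow> complex ^ 'n ^ 'n) \<Rightarrow>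
    (complex ^ 'n) set \<Rightarrow> 'g \<Rightarrow> complex ^ 'n \<Rightarrow> complex ^ 'n" where
  "square_endo h \<tau> W g v = tau_sq h \<tau> W g (hproj h W v)"

definition root_endo :: "(complex ^ 'n \<Rightarrow> complex ^ 'n \<Rightarrow> complex) \<Rightarrow> ('g \<Rightarrow> complex ^ 'n ^ 'n) \<Rightarrow>
    (complex ^ 'n) set \<Rightarrow> 'g \<Rightarrow> complex ^ 'n \<Rightarrow> complex ^ 'n" where
  "root_endo h \<tau> W g v = sqrt_on h W (tau_sq h \<tau> W g) (hproj h W v)"

text \<open>What \<open>g \<in> M(W)\<close> contributes to the linear algebra: \<open>\<tau>(g)\<close> restricts to an automorphism of \<open>W\<close>.\<close>
definition boundary_datum :: "('g \<Rightarrow> complex ^ 'n ^ 'n) \<Rightarrow> (complex ^ 'n) set \<Rightarrow> 'g \<Rightarrow> bool" where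
  "boundary_datum \<tau> W g \<longleftrightarrow> vec.subspace W \<and> W \<noteq> {0} \<and> (*v) (\<tau> g) ` W = W"

lemma boundary_datumD:
  assumes "boundary_datum \<tau> W g"
  shows "vec.subspace W" "W \<noteq> {0}" "(*v) (\<tau> g) ` W = W"
  using assms by (auto simp: boundary_datum_def)

context hermitian_space
begin

text \<open>With \<open>S\<close> the adjoint of \<open>T = \<tau>\<^sub>W(g)\<close> and \<open>P\<close> the projection to \<open>W\<close>, the associated form is
  \<open>h (S (P u)) (S (P v))\<close>. It is positive, and its kernel is that of \<open>P\<close> because \<open>T\<close> is onto \<open>W\<close>, so that
  \<open>S\<close> is injective.\<close>
lemma square_endo:
  assumes datum: "boundary_datum \<tau> W g"
  shows positive_square_endo: "positive (square_endo h \<tau> W g)"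
    and square_endo_zero_iff: "square_endo h \<tau> W g v = 0 \<longleftrightarrow> v \<in> hperp h W"
proof -
  note W = boundary_datumD(1)[OF datum] and g = boundary_datumD(3)[OF datum]
  define T where "T = (\<lambda>w\<in>W. \<tau> g *v w)"
  define S where "S = adj_on h W T"
  have T: "T w = \<tau> g *v w" if "w \<in> W" for w using that by (simp add: T_def)
  have T_add: "T (u + v) = T u + T v" if "u \<in> W" "v \<in> W" for u v
    using that W by (simp add: T vec.subspace_add matrix_vector_right_distrib)
  have T_scale: "T (c *s v) = c *s T v" if "v \<in> W" for c v
    using that W by (simp add: T vec.subspace_scale vec.scale)
  have T_image: "T ` W = W" using g T by (metis image_cong)
  have S_in: "S w \<in> W" if "w \<in> W" for w
    unfolding S_def by (rule adj_on_in[OF W T_add T_scale that])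
  have adj: "h (T v) w = h v (S w)" if "v \<in> W" "w \<in> W" for v w
    unfolding S_def by (rule h_adj_on[OF W T_add T_scale that(2,1)])
  define P where "P = hproj h W"
  have P_in: "P v \<in> W" for v unfolding P_def by (rule hproj_in[OF W])
  have F: "square_endo h \<tau> W g v = T (S (P v))" for v
    using P_in[of v] by (simp add: square_endo_def tau_sq_def Let_def T_def[symmetric] S_def[symmetric] P_def[symmetric])
  have in_W: "square_endo h \<tau> W g v \<in> W" for v using T_image S_in P_in by (auto simp: F)
  have form: "h (square_endo h \<tau> W g u) v = h (S (P u)) (S (P v))" for u v
    using h_hproj_right[OF W in_W, of u v] adj[OF S_in[OF P_in] P_in] by (simp add: F P_def)
  have "self_adjoint (square_endo h \<tau> W g)"
  proof (rule self_adjointI)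
    fix v w
    have "h v (square_endo h \<tau> W g w) = cnj (h (S (P w)) (S (P v)))" by (subst h_cnj) (simp add: form)
    then show "h (square_endo h \<tau> W g v) w = h v (square_endo h \<tau> W g w)"
      using h_cnj[of "S (P w)" "S (P v)"] by (simp add: form)
  qed
  then show positive: "positive (square_endo h \<tau> W g)"
    using h_self_nonneg by (simp add: positive_def form)
  show "square_endo h \<tau> W g v = 0 \<longleftrightarrow> v \<in> hperp h W"
  proof
    assume "square_endo h \<tau> W g v = 0"
    then have "S (P v) = 0" using form[of v v] by simp
    then have "h (T x) (P v) = 0" if "x \<in> W" for x using adj[OF that P_in, of v] by simp
    then have "h (P v) (P v) = 0" using T_image P_in by (metis imageE)
    then show "v \<in> hperp h W" using hproj_zero_iff[OF W] by (simp add: P_def)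
  next
    assume "v \<in> hperp h W"
    then have "P v = 0" "P 0 = 0"
      using hproj_zero_iff[OF W] hproj_self[OF W vec.subspace_0[OF W]] by (simp_all add: P_def)
    then have "square_endo h \<tau> W g v = square_endo h \<tau> W g 0" by (simp add: F)
    then show "square_endo h \<tau> W g v = 0"
      using self_adjoint_simps(4)[OF positive_self_adjoint[OF positive]] by simp
  qed
qed

text \<open>Roots on \<open>W\<close> and roots of the extension by zero correspond to each other, so that existence and uniqueness on
  \<open>W\<close> reduce to the whole space.\<close>
lemma sqrt_on_eq_restrict:
  assumes W: "vec.subspace W" and s: "positive s"
    and s_in: "\<And>v. s v \<in> W" and sq: "\<And>w. w \<in> W \<Longrightarrow> s (s w) = f w"
    and ker: "\<And>v. v \<in> hperp h W \<Longrightarrow> s v = 0"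
  shows "sqrt_on h W f = restrict s W"
  unfolding sqrt_on_def
proof (rule the_equality)
  note s_sa = positive_self_adjoint[OF s]
  note s_simps = self_adjoint_simps[OF s_sa]
  show "restrict s W \<in> W \<rightarrow>\<^sub>E W \<and>
     (\<forall>v\<in>W. \<forall>w\<in>W. restrict s W (v + w) = restrict s W v + restrict s W w) \<and>
     (\<forall>c. \<forall>v\<in>W. restrict s W (c *s v) = c *s restrict s W v) \<and>
     (\<forall>v\<in>W. \<forall>w\<in>W. h (restrict s W v) w = h v (restrict s W w)) \<and>
     (\<forall>v\<in>W. Re (h (restrict s W v) v) \<ge> 0) \<and> (\<forall>v\<in>W. restrict s W (restrict s W v) = f v)"
    using s_in sq positive_nonneg[OF s]
    by (simp add: vec.subspace_add[OF W] vec.subspace_scale[OF W] s_simps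
        self_adjoint_swap[OF s_sa])
  fix r assume r: "r \<in> W \<rightarrow>\<^sub>E W \<and>
     (\<forall>v\<in>W. \<forall>w\<in>W. r (v + w) = r v + r w) \<and> (\<forall>c. \<forall>v\<in>W. r (c *s v) = c *s r v) \<and>
     (\<forall>v\<in>W. \<forall>w\<in>W. h (r v) w = h v (r w)) \<and> (\<forall>v\<in>W. Re (h (r v) v) \<ge> 0) \<and>
     (\<forall>v\<in>W. r (r v) = f v)"
  define P where "P = hproj h W"
  have P: "P v \<in> W" for v unfolding P_def by (rule hproj_in[OF W])
  have r_in: "r w \<in> W" if "w \<in> W" for w using r that by auto
  have r_form: "h (r (P v)) w = h (r (P v)) (P w)" for v w
    using h_hproj_right[OF W r_in[OF P]] by (simp add: P_def)
  have r_form': "h v (r (P w)) = h (P v) (r (P w))" for v w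
    using h_hproj_left[OF W r_in[OF P]] by (simp add: P_def)
  have "self_adjoint (\<lambda>v. r (P v))"
  proof (rule self_adjointI)
    show "h (r (P v)) w = h v (r (P w))" for v w
      using r P by (simp add: r_form[of v w] r_form'[of v w])
  qed
  moreover have "Re (h (r (P v)) v) \<ge> 0" for v
    unfolding r_form[of v v] using r P by blast
  ultimately have "positive (\<lambda>v. r (P v))" by (simp add: positive_def)
  then have "(\<lambda>v. r (P v)) = s"
  proof (rule positive_sqrt_unique[OF _ s])
    fix v
    have "r (P (r (P v))) = f (P v)"
      using r P r_in hproj_self[OF W] by (simp add: P_def)
    also have "\<dots> = s (s (P v))" using sq[OF P] by simp
    also have "s (P v) = s v"
      using ker[OF hproj_residue[OF W, of v]] by (simp add: s_simps P_def)
    finally show "r (P (r (P v))) = s (s v)" .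
  qed
  then have "r w = s w" if "w \<in> W" for w
    using that hproj_self[OF W that] by (metis P_def)
  then show "r = restrict s W" using r by (auto simp: fun_eq_iff PiE_def extensional_def)
qed

text \<open>A positive square root has the same kernel \<open>W\<^sup>\<bottom>\<close> as its square, and therefore takes values in \<open>W\<close>.\<close>
lemma root_endo:
  assumes datum: "boundary_datum \<tau> W g"
  shows positive_root_endo: "positive (root_endo h \<tau> W g)"
    and root_endo_square: "root_endo h \<tau> W g (root_endo h \<tau> W g v) = square_endo h \<tau> W g v"
    and root_endo_zero_iff: "root_endo h \<tau> W g v = 0 \<longleftrightarrow> v \<in> hperp h W"
proof -
  note W = boundary_datumD(1)[OF datum]
  define F where "F = square_endo h \<tau> W g"
  obtain s where s: "positive s" and sq: "\<And>v. s (s v) = F v"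
    using positive_sqrt_exists[OF positive_square_endo[OF datum]] by (auto simp: F_def)
  note s_sa = positive_self_adjoint[OF s]
  have ker: "s v = 0 \<longleftrightarrow> v \<in> hperp h W" for v
  proof -
    have "s v = 0 \<longleftrightarrow> F v = 0"
    proof
      assume "F v = 0"
      then have "h (s v) (s v) = 0" using self_adjoint_swap[OF s_sa, of v "s v"] by (simp add: sq)
      then show "s v = 0" by simp
    next
      assume "s v = 0"
      then show "F v = 0" using sq[of v] self_adjoint_simps(4)[OF s_sa] by simp
    qed
    then show ?thesis using square_endo_zero_iff[OF datum] by (simp add: F_def)
  qed
  have s_in: "s v \<in> W" for v
  proof (rule double_hperp[OF W])
    fix u assume "u \<in> hperp h W"
    then have "s u = 0" using ker by blast
    then show "h (s v) u = 0" by (simp add: self_adjoint_swap[OF s_sa])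
  qed
  have "F w = tau_sq h \<tau> W g w" if "w \<in> W" for w
    using hproj_self[OF W that] by (simp add: F_def square_endo_def)
  then have "sqrt_on h W (tau_sq h \<tau> W g) = restrict s W"
    using sq ker by (intro sqrt_on_eq_restrict[OF W s s_in]) auto
  then have "root_endo h \<tau> W g v = s (hproj h W v)" for v
    using hproj_in[OF W] by (simp add: root_endo_def)
  also have "s (hproj h W v) = s v" for v
    using hproj_residue[OF W, of v] by (simp add: ker[symmetric] self_adjoint_simps[OF s_sa])
  finally have R: "root_endo h \<tau> W g = s" by blast
  show "positive (root_endo h \<tau> W g)" "root_endo h \<tau> W g (root_endo h \<tau> W g v) = square_endo h \<tau> W g v"
    "root_endo h \<tau> W g v = 0 \<longleftrightarrow> v \<in> hperp h W"
    by (simp_all add: R s sq ker F_def)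
qed

lemma root_endo_nonzero:
  assumes datum: "boundary_datum \<tau> W g"
  shows "\<exists>v. root_endo h \<tau> W g v \<noteq> 0"
proof -
  note W = boundary_datumD[OF datum]
  obtain w where w: "w \<in> W" "w \<noteq> 0" using W(2) vec.subspace_0[OF W(1)] by blast
  then have "w \<notin> hperp h W" using mem_hperp_self by blast
  then show ?thesis using root_endo_zero_iff[OF datum] by blast
qed

text \<open>A point of the projective space of Hermitian endomorphisms is a real line, and among the
  nonzero real multiples of a nonzero positive endomorphism only those by positive numbers are positive. Uniqueness of square roots turns a
  factor \<open>k\<close> between the squares into the factor \<open>sqrt k\<close> between the roots.\<close>
lemma satake_point_eq_iff:
  assumes W: "boundary_datum \<tau> W g" and W': "boundary_datum \<tau> W' g'"
  shows "satake_point h \<tau> W g = satake_point h \<tau> W' g' \<longleftrightarrow>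
    (\<exists>r>0. \<forall>v. root_endo h \<tau> W g v = complex_of_real r *s root_endo h \<tau> W' g' v)"
proof -
  define F F' where "F = square_endo h \<tau> W g" and "F' = square_endo h \<tau> W' g'"
  define A A' where "A = root_endo h \<tau> W g" and "A' = root_endo h \<tau> W' g'"
  have A: "positive A" "\<And>v. A (A v) = F v" and A': "positive A'" "\<And>v. A' (A' v) = F' v"
    using root_endo[OF W] root_endo[OF W'] by (simp_all add: F_def F'_def A_def A'_def)
  have F: "positive F" and F': "positive F'"
    unfolding F_def F'_def by (rule positive_square_endo[OF W], rule positive_square_endo[OF W'])
  have matrix_F: "matrix F *v v = F v" "matrix F' *v v = F' v" for v
    using F F' by (auto intro!: matrix_works self_adjoint_linear positive_self_adjoint)
  have span_eq: "satake_point h \<tau> W g = span {matrix F}" "satake_point h \<tau> W' g' = span {matrix F'}"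
    by (simp_all add: satake_point_def F_def F'_def square_endo_def[abs_def])
  show ?thesis unfolding span_eq A_def[symmetric] A'_def[symmetric]
  proof
    assume "span {matrix F} = span {matrix F'}"
    then have "matrix F \<in> span {matrix F'}" using span_base by blast
    then obtain k where k: "matrix F = k *\<^sub>R matrix F'" by (auto simp: span_singleton)
    have F_eq: "F v = complex_of_real k *s F' v" for v
      using scaleR_matrix_vector_mult[of k "matrix F'" v] by (simp add: k[symmetric] matrix_F)
    obtain w where w: "w \<in> W" "w \<noteq> 0" using boundary_datumD[OF W] vec.subspace_0 by blast
    have "F w \<noteq> 0" using mem_hperp_self[of w W] w square_endo_zero_iff[OF W] by (auto simp: F_def)
    then have "Re (h (F w) w) \<noteq> 0" using positive_isotropic_in_kernel[OF F] by blast
    then have "k * Re (h (F' w) w) > 0"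
      using positive_nonneg[OF F, of w] F_eq[of w]
      by (simp add: h_scale_left order_less_le)
    then have "k > 0" using positive_nonneg[OF F', of w] by (simp add: zero_less_mult_iff)
    have sqrt_k: "complex_of_real (sqrt k) * complex_of_real (sqrt k) = complex_of_real k"
      using \<open>k > 0\<close> by (simp add: of_real_mult[symmetric] del: of_real_mult)
    have "A = (\<lambda>v. complex_of_real (sqrt k) *s A' v)"
    proof (rule positive_sqrt_unique[OF A(1)])
      show "positive (\<lambda>v. complex_of_real (sqrt k) *s A' v)"
        using A'(1) \<open>k > 0\<close> by (intro positive_scale) auto
      show "A (A v) = complex_of_real (sqrt k) *s A' (complex_of_real (sqrt k) *s A' v)" for v
        by (simp add: A A' F_eq self_adjoint_simps[OF positive_self_adjoint[OF A'(1)]] sqrt_k)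
    qed
    then show "\<exists>r>0. \<forall>v. A v = complex_of_real r *s A' v"
      using \<open>k > 0\<close> by (intro exI[of _ "sqrt k"]) simp
  next
    assume "\<exists>r>0. \<forall>v. A v = complex_of_real r *s A' v"
    then obtain r where r: "r > 0" "\<And>v. A v = complex_of_real r *s A' v" by blast
    have "F v = complex_of_real (r * r) *s F' v" for v
      using A(2)[of v] A'(2)[of v]
      by (simp add: r(2) self_adjoint_simps[OF positive_self_adjoint[OF A'(1)]])
    then have M: "matrix F = (r * r) *\<^sub>R matrix F'"
      by (simp add: matrix_eq scaleR_matrix_vector_mult matrix_F)
    have M': "matrix F' = (1 / (r * r)) *\<^sub>R matrix F" using r(1) by (simp add: M)
    have "matrix F \<in> span {matrix F'}" unfolding M by (intro span_scale span_base) simp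
    moreover have "matrix F' \<in> span {matrix F}" by (subst M', intro span_scale span_base) simp
    ultimately show "span {matrix F} = span {matrix F'}"
      by (intro subset_antisym span_minimal subspace_span) auto
  qed
qed

end

section \<open>Smooth functions and stabilizers\<close>

lemma continuous_map_smooth_fun:
  fixes f :: "'g \<Rightarrow> 'b::real_normed_vector"
  assumes G: "lie_group G" and f: "smooth_fun G f"
  shows "continuous_map (topol G) euclidean f"
proof -
  have chart: "continuous_map (subtopology (topol G) U) euclidean f"
    if chart: "(U, \<phi>) \<in> charts G" for U \<phi>
  proof -
    have U: "openin (topol G) U" and \<phi>: "homeomorphic_map (subtopology (topol G) U) (top_of_set (\<phi> ` U)) \<phi>"
      using G chart unfolding lie_group_def by auto
    have topspace_U: "topspace (subtopology (topol G) U) = U"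
      by (rule topspace_subtopology_subset[OF openin_subset[OF U]])
    have "Ck_on 0 (\<phi> ` U) (f \<circ> inv_into U \<phi>)"
      using f chart unfolding smooth_fun_def smooth_on_def by blast
    then have "continuous_map (top_of_set (\<phi> ` U)) euclidean (f \<circ> inv_into U \<phi>)" by simp
    then have "continuous_map (subtopology (topol G) U) euclidean ((f \<circ> inv_into U \<phi>) \<circ> \<phi>)"
      by (rule continuous_map_compose[OF homeomorphic_imp_continuous_map[OF \<phi>]])
    then show ?thesis
    proof (rule continuous_map_eq)
      fix x assume "x \<in> topspace (subtopology (topol G) U)"
      then show "((f \<circ> inv_into U \<phi>) \<circ> \<phi>) x = f x"
        using homeomorphic_imp_injective_map[OF \<phi>] by (simp add: topspace_U del: topspace_subtopology)
    qed
  qed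
  show ?thesis
    unfolding continuous_map_def
  proof (intro conjI allI impI)
    fix V :: "'b set" assume V: "openin euclidean V"
    show "openin (topol G) {x \<in> topspace (topol G). f x \<in> V}"
    proof (subst openin_subopen, intro ballI)
      fix x assume x: "x \<in> {x \<in> topspace (topol G). f x \<in> V}"
      then obtain U \<phi> where U: "(U, \<phi>) \<in> charts G" "x \<in> U"
        using G unfolding lie_group_def by blast
      have open_U: "openin (topol G) U" using G U(1) unfolding lie_group_def by auto
      let ?T = "{y \<in> topspace (subtopology (topol G) U). f y \<in> V}"
      have "openin (topol G) ?T"
        by (rule openin_trans_full[OF openin_continuous_map_preimage[OF chart[OF U(1)] V] open_U])
      then show "\<exists>T. openin (topol G) T \<and> x \<in> T \<and> T \<subseteq> {x \<in> topspace (topol G). f x \<in> V}"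
        using x U(2) by (intro exI[of _ ?T]) auto
    qed
  qed simp
qed

text \<open>\<open>M(W)\<close> is contained in \<open>L \<subseteq> Q(W)\<close>: the exponential of an element of the Lie algebra of \<open>L\<close>
  lies in \<open>L\<close>, by time \<open>1\<close> in the definition of that Lie algebra.\<close>
lemma M_of_stabilizes:
  assumes \<tau>: "\<tau> \<in> hom G SL" and g: "g \<in> M_of G K \<theta> \<tau> W"
  shows "(*v) (\<tau> g) ` W = W"
proof -
  obtain k X where g_eq: "g = k \<otimes>\<^bsub>G\<^esub> lie_exp G X" and k: "k \<in> L_of G \<theta> \<tau> W"
    and X: "X \<in> lie_of_subgroup G (L_of G \<theta> \<tau> W)"
    using g unfolding M_of_def l_of_def by blast
  have "lie_exp G (vscale 1 X) \<in> L_of G \<theta> \<tau> W" using X unfolding lie_of_subgroup_def by blast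
  then have "lie_exp G X \<in> Q_of G \<tau> W" by (simp add: vscale_def L_of_def)
  moreover have "k \<in> Q_of G \<tau> W" using k by (simp add: L_of_def)
  ultimately have "(*v) (\<tau> k ** \<tau> (lie_exp G X)) ` W = W"
    by (simp add: Q_of_def matrix_vector_mul_assoc[symmetric] image_image[symmetric, of "(*v) (\<tau> k)" "(*v) (\<tau> (lie_exp G X))"])
  moreover have "\<tau> g = \<tau> k ** \<tau> (lie_exp G X)"
    using \<tau> \<open>lie_exp G X \<in> Q_of G \<tau> W\<close> \<open>k \<in> Q_of G \<tau> W\<close>
    by (simp add: g_eq hom_def Q_of_def SL_def)
  ultimately show ?thesis by simp
qed

section \<open>Orbits of lines\<close>

lemma line_eq_span:
  assumes "x \<in> proj_space UNIV" "v \<in> x" "v \<noteq> 0"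
  shows "x = vec.span {v}"
proof -
  obtain w where w: "x = vec.span {w}" using assms(1) by (auto simp: proj_space_def)
  obtain c where c: "v = c *s w" using assms(2) by (auto simp: w vec.span_singleton)
  then have "w = (1 / c) *s v" using assms(3) by (auto simp: vector_smult_assoc)
  then have "w \<in> vec.span {v}" by (metis vec.span_base vec.span_scale singletonI)
  moreover have "v \<in> vec.span {w}" using assms(2) w by simp
  ultimately show ?thesis unfolding w by (intro vec.span_eq[THEN iffD2]) auto
qed

lemma mem_proj_space_line:
  assumes "vec.subspace W" "v \<noteq> 0"
  shows "vec.span {v} \<in> proj_space W \<longleftrightarrow> v \<in> W"
  using assms vec.span_minimal[of "{_}" W] vec.span_base[of v "{v}"]
  unfolding proj_space_def by blast

lemma orbit_cone:
  assumes G: "group G" and \<tau>: "\<tau> \<in> hom G SL" and Orb: "closed_orbit (\<tau> ` carrier G) Orb"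
  shows orbit_lines: "Orb \<subseteq> proj_space UNIV"
    and orbit_cone_invariant: "g \<in> carrier G \<Longrightarrow> (*v) (\<tau> g) ` \<Union>Orb = \<Union>Orb"
    and orbit_cone_nonzero: "\<exists>v\<in>\<Union>Orb. v \<noteq> 0"
    and rep_inj: "g \<in> carrier G \<Longrightarrow> inj ((*v) (\<tau> g))"
    and rep_one: "\<tau> \<one>\<^bsub>G\<^esub> = mat 1"
proof -
  interpret group G by (rule G)
  have det: "det (\<tau> g) = 1" if "g \<in> carrier G" for g
    using \<tau> that by (auto simp: hom_def SL_def)
  have mult: "\<tau> (a \<otimes>\<^bsub>G\<^esub> b) = \<tau> a ** \<tau> b" if "a \<in> carrier G" "b \<in> carrier G" for a b
    using \<tau> that by (auto simp: hom_def SL_def)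
  show inj: "inj ((*v) (\<tau> g))" if "g \<in> carrier G" for g
    using det[OF that] invertible_det_nz[of "\<tau> g"] by (simp add: inj_matrix_vector_mult)
  show one: "\<tau> \<one>\<^bsub>G\<^esub> = mat 1"
  proof -
    have "\<tau> \<one>\<^bsub>G\<^esub> *v (\<tau> \<one>\<^bsub>G\<^esub> *v v) = \<tau> \<one>\<^bsub>G\<^esub> *v v" for v
      using mult[OF one_closed one_closed] by (simp add: matrix_vector_mul_assoc)
    then have "\<tau> \<one>\<^bsub>G\<^esub> *v v = v" for v using inj[OF one_closed] by (meson injD)
    then show ?thesis by (simp add: matrix_eq)
  qed
  obtain x\<^sub>0 where x\<^sub>0: "x\<^sub>0 \<in> proj_space UNIV" "Orb = (\<lambda>A. (*v) A ` x\<^sub>0) ` \<tau> ` carrier G"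
    using Orb unfolding closed_orbit_def by blast
  then obtain v where v: "x\<^sub>0 = vec.span {v}" "v \<noteq> 0" by (auto simp: proj_space_def)
  have nonzero: "\<tau> a *v v \<noteq> 0" if "a \<in> carrier G" for a
    using injD[OF inj[OF that], of v 0] v(2) by auto
  show "Orb \<subseteq> proj_space UNIV"
  proof
    fix x assume "x \<in> Orb"
    then obtain a where a: "a \<in> carrier G" "x = (*v) (\<tau> a) ` x\<^sub>0" using x\<^sub>0(2) by blast
    have "x = vec.span {\<tau> a *v v}"
      using vec.linear_span_image[OF matrix_vector_mul_linear_gen, of "\<tau> a" "{v}"] by (simp add: a(2) v(1))
    then show "x \<in> proj_space UNIV" using nonzero[OF a(1)] unfolding proj_space_def by blast
  qed
  have cone: "\<Union>Orb = (\<Union>a\<in>carrier G. (*v) (\<tau> a) ` x\<^sub>0)" using x\<^sub>0(2) by blast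
  show "\<exists>v\<in>\<Union>Orb. v \<noteq> 0"
    using nonzero[OF one_closed] v(1) vec.span_base[of v "{v}"] one_closed unfolding cone by blast
  show "(*v) (\<tau> g) ` \<Union>Orb = \<Union>Orb" if g: "g \<in> carrier G"
  proof -
    have step: "(*v) (\<tau> b) ` (*v) (\<tau> a) ` x\<^sub>0 = (*v) (\<tau> (b \<otimes>\<^bsub>G\<^esub> a)) ` x\<^sub>0"
      if "a \<in> carrier G" "b \<in> carrier G" for a b
      using that by (simp add: mult image_image matrix_vector_mul_assoc)
    have "(*v) (\<tau> g) ` \<Union>Orb = (\<Union>a\<in>carrier G. (*v) (\<tau> (g \<otimes>\<^bsub>G\<^esub> a)) ` x\<^sub>0)"
      unfolding cone image_UN using step g by simp
    also have "\<dots> = (\<Union>a\<in>(\<lambda>a. g \<otimes>\<^bsub>G\<^esub> a) ` carrier G. (*v) (\<tau> a) ` x\<^sub>0)" by blast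
    also have "(\<lambda>a. g \<otimes>\<^bsub>G\<^esub> a) ` carrier G = carrier G" using g by (rule surj_const_mult)
    finally show ?thesis by (simp add: cone)
  qed
qed

section \<open>Injectivity\<close>

lemma R_map_eq:
  "R_map h \<tau> Orb W g x =
    (if x \<in> Orb - proj_space (hperp h W) then Some (root_endo h \<tau> W g ` x) else None)"
  by (simp add: R_map_def root_endo_def[abs_def])

context hermitian_space
begin

text \<open>The domain is determined by \<open>W\<^sup>\<bottom>\<close>, the kernel of the root, and a nonzero factor does not change the image of
  a line.\<close>
lemma R_map_cong:
  assumes W: "boundary_datum \<tau> W g" and W': "boundary_datum \<tau> W' g'"
    and Orb: "Orb \<subseteq> proj_space UNIV"
    and r: "r > 0" "\<And>v. root_endo h \<tau> W g v = complex_of_real r *s root_endo h \<tau> W' g' v"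
  shows "R_map h \<tau> Orb W g = R_map h \<tau> Orb W' g'"
proof
  fix x
  have "hperp h W = hperp h W'"
    using r root_endo_zero_iff[OF W] root_endo_zero_iff[OF W'] by (auto simp: vec.scale_eq_0_iff)
  moreover have "root_endo h \<tau> W g ` x = root_endo h \<tau> W' g' ` x" if x: "x \<in> Orb"
  proof -
    note R'_simps = self_adjoint_simps[OF positive_self_adjoint[OF positive_root_endo[OF W']]]
    have sub: "vec.subspace x" using x Orb by (auto simp: proj_space_def)
    have eq: "root_endo h \<tau> W g v = root_endo h \<tau> W' g' (complex_of_real r *s v)" for v
      by (simp add: r(2) R'_simps)
    have "(\<lambda>v. complex_of_real r *s v) ` x = x"
    proof
      show "x \<subseteq> (\<lambda>v. complex_of_real r *s v) ` x"
      proof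
        fix v assume "v \<in> x"
        then show "v \<in> (\<lambda>v. complex_of_real r *s v) ` x"
          using r(1) sub by (intro image_eqI[of _ _ "complex_of_real (1 / r) *s v"])
            (auto simp: vector_smult_assoc vec.subspace_scale)
      qed
    qed (use sub in \<open>auto simp: vec.subspace_scale\<close>)
    then show ?thesis unfolding eq by (metis image_image)
  qed
  ultimately show "R_map h \<tau> Orb W g x = R_map h \<tau> Orb W' g' x" by (simp add: R_map_eq)
qed

text \<open>Where both maps are defined they give the same line, and where one is undefined the corresponding root
  vanishes. So the two roots are parallel on the whole cone over the orbit and not only over the common domain.\<close>
lemma rat_eq_imp_proportional:
  assumes W: "boundary_datum \<tau> W g" and W': "boundary_datum \<tau> W' g'"
    and Orb: "Orb \<subseteq> proj_space UNIV"
    and thick: "\<And>F. finite F \<Longrightarrow> (\<And>U. U \<in> F \<Longrightarrow> vec.subspace U) \<Longrightarrow> \<Union>Orb \<subseteq> \<Union>F \<Longrightarrow> UNIV \<in> F"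
    and eq: "rat_eq (R_map h \<tau> Orb W g) (R_map h \<tau> Orb W' g')"
  shows "\<exists>r>0. \<forall>v. root_endo h \<tau> W g v = complex_of_real r *s root_endo h \<tau> W' g' v"
proof -
  define A B where "A = root_endo h \<tau> W g" and "B = root_endo h \<tau> W' g'"
  have A: "positive A" "\<And>v. A v = 0 \<longleftrightarrow> v \<in> hperp h W"
    and B: "positive B" "\<And>v. B v = 0 \<longleftrightarrow> v \<in> hperp h W'"
    using root_endo[OF W] root_endo[OF W'] by (simp_all add: A_def B_def)
  note B_simps = self_adjoint_simps[OF positive_self_adjoint[OF B(1)]]
  obtain a b where ab: "A a \<noteq> 0" "B b \<noteq> 0"
    using root_endo_nonzero[OF W] root_endo_nonzero[OF W'] by (auto simp: A_def B_def)
  have parallel: "\<exists>c. A v = c *s B v" if v: "v \<in> \<Union>Orb" "B v \<noteq> 0" for v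
  proof (cases "A v = 0")
    case True
    then show ?thesis by (intro exI[of _ 0]) simp
  next
    case False
    have "v \<noteq> 0" using v(2) by (auto simp: B_simps)
    then have x: "vec.span {v} \<in> Orb" using v(1) Orb line_eq_span by (metis Union_iff subsetD)
    have "vec.span {v} \<notin> proj_space (hperp h W)" "vec.span {v} \<notin> proj_space (hperp h W')"
      using False v(2) A(2) B(2) \<open>v \<noteq> 0\<close> by (simp_all add: mem_proj_space_line subspace_hperp)
    then have lines: "R_map h \<tau> Orb W g (vec.span {v}) = Some (A ` vec.span {v})"
        "R_map h \<tau> Orb W' g' (vec.span {v}) = Some (B ` vec.span {v})"
      using x by (simp_all add: R_map_eq A_def B_def)
    then have "vec.span {v} \<in> dom (R_map h \<tau> Orb W g) \<inter> dom (R_map h \<tau> Orb W' g')"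
      by (simp add: domI)
    then have "A ` vec.span {v} = B ` vec.span {v}"
      using eq lines unfolding rat_eq_def by (metis option.inject)
    moreover have "A v \<in> A ` vec.span {v}" by (intro imageI vec.span_base) simp
    ultimately obtain u where "u \<in> vec.span {v}" "A v = B u" by auto
    then obtain c where "A v = B (c *s v)" by (auto simp: vec.span_singleton)
    then show ?thesis by (auto simp: B_simps)
  qed
  show ?thesis
    using parallel_imp_proportional[where C = "\<Union>Orb", OF A(1) B(1) ab thick parallel]
    by (simp add: A_def B_def)
qed

end

theorem theorem76:
  fixes G :: "('g, 'e::euclidean_space) lie_struct"
    and K :: "'g set" and \<theta> :: "'g \<Rightarrow> 'g"
    and \<tau> :: "'g \<Rightarrow> complex ^ 'n ^ 'n"
    and h :: "complex ^ 'n \<Rightarrow> complex ^ 'n \<Rightarrow> complex"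
    and Orb' Orb :: "(complex ^ 'n) set set"
  assumes "lie_group G" and "connected_space (topol G)" and "\<not> compact_space (topol G)"
    and "semisimple_group G" and "finite (group_center G)"
    and "maximal_compact_subgroup G K"
    and "cartan_involution G \<theta>" and "K = {g \<in> carrier G. \<theta> g = g}"
    and "\<tau> \<in> hom G SL" and "smooth_fun G \<tau>"
    and "finite {g \<in> carrier G. \<tau> g = mat 1}"
    and "acts_irreducibly (\<tau> ` carrier G) UNIV"
    and "hermitian_product h" and "compatible G K \<theta> \<tau> h"
    and "closed_orbit (zariski_closure_SL (\<tau> ` carrier G)) Orb'"
    and "closed_orbit (\<tau> ` carrier G) Orb" and "Orb \<subseteq> Orb'"
  shows "(\<forall>W g. tau_connected G \<tau> W \<and> g \<in> M_of G K \<theta> \<tau> W \<longrightarrow>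
           ri G K \<theta> \<tau> h Orb (satake_point h \<tau> W g) = R_map h \<tau> Orb W g) \<and>
         rat_inj_on (ri G K \<theta> \<tau> h Orb)
           (satake_compactification G \<tau> h \<inter> satake_strata G K \<theta> \<tau> h) \<and>
         (satake_compactification G \<tau> h = satake_strata G K \<theta> \<tau> h \<longrightarrow>
           rat_inj_on (ri G K \<theta> \<tau> h Orb) (satake_compactification G \<tau> h))"
proof -
  interpret hermitian_space h by unfold_locales (rule assms)
  have G: "group G" "topspace (topol G) = carrier G" using assms(1) by (auto simp: lie_group_def)
  note lines = orbit_lines[OF G(1) assms(9,16)]
  have thick: "UNIV \<in> F" if F: "finite F" "\<And>U. U \<in> F \<Longrightarrow> vec.subspace U" "\<Union>Orb \<subseteq> \<Union>F" for F
  proof -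
    obtain v where v: "v \<in> \<Union>Orb" "v \<noteq> 0" using orbit_cone_nonzero[OF G(1) assms(9,16)] by blast
    show ?thesis
    proof (rule irreducible_not_covered[OF assms(2) continuous_map_smooth_fun[OF assms(1,10)]])
      show "\<one>\<^bsub>G\<^esub> \<in> topspace (topol G)" using G by (simp add: group.is_monoid monoid.one_closed)
      show "\<tau> \<one>\<^bsub>G\<^esub> = mat 1" by (rule rep_one[OF G(1) assms(9,16)])
      show "inj ((*v) (\<tau> g))" if "g \<in> topspace (topol G)" for g
        using that by (simp add: G(2) rep_inj[OF G(1) assms(9,16)])
      show "acts_irreducibly (\<tau> ` topspace (topol G)) UNIV" using assms(12) by (simp add: G(2))
      show "(*v) (\<tau> g) ` \<Union>Orb = \<Union>Orb" if "g \<in> topspace (topol G)" for g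
        using that orbit_cone_invariant[OF G(1) assms(9,16)] by (simp add: G(2))
    qed (fact v F)+
  qed
  define stratum where "stratum W g \<longleftrightarrow> tau_connected G \<tau> W \<and> g \<in> M_of G K \<theta> \<tau> W" for W g
  have stratum: "boundary_datum \<tau> W g" if "stratum W g" for W g
    using that M_of_stabilizes[OF assms(9), of g K \<theta> W]
    by (simp add: stratum_def tau_connected_def boundary_datum_def)
  have well_defined: "R_map h \<tau> Orb W g = R_map h \<tau> Orb W' g'"
    if "stratum W g" "stratum W' g'" "satake_point h \<tau> W g = satake_point h \<tau> W' g'" for W g W' g'
    using satake_point_eq_iff[OF stratum[OF that(1)] stratum[OF that(2)]] that(3)
      R_map_cong[OF stratum[OF that(1)] stratum[OF that(2)] lines] by blast
  have ri: "ri G K \<theta> \<tau> h Orb (satake_point h \<tau> W g) = R_map h \<tau> Orb W g" if s: "stratum W g" for W g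
    unfolding ri_def
  proof (rule the_equality)
    show "\<exists>W' g'. tau_connected G \<tau> W' \<and> g' \<in> M_of G K \<theta> \<tau> W' \<and>
        satake_point h \<tau> W g = satake_point h \<tau> W' g' \<and> R_map h \<tau> Orb W g = R_map h \<tau> Orb W' g'"
      using s unfolding stratum_def by blast
    fix R assume "\<exists>W' g'. tau_connected G \<tau> W' \<and> g' \<in> M_of G K \<theta> \<tau> W' \<and>
        satake_point h \<tau> W g = satake_point h \<tau> W' g' \<and> R = R_map h \<tau> Orb W' g'"
    then obtain W' g' where "stratum W' g'" "satake_point h \<tau> W g = satake_point h \<tau> W' g'"
      "R = R_map h \<tau> Orb W' g'"
      unfolding stratum_def by blast
    then show "R = R_map h \<tau> Orb W g" using well_defined[OF s] by simp
  qed
  have inj: "rat_inj_on (ri G K \<theta> \<tau> h Orb) (satake_strata G K \<theta> \<tau> h)"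
    unfolding rat_inj_on_def
  proof (intro ballI impI)
    fix p q assume "p \<in> satake_strata G K \<theta> \<tau> h" "q \<in> satake_strata G K \<theta> \<tau> h"
      and eq: "rat_eq (ri G K \<theta> \<tau> h Orb p) (ri G K \<theta> \<tau> h Orb q)"
    then obtain W g W' g' where p: "p = satake_point h \<tau> W g" "stratum W g"
      and q: "q = satake_point h \<tau> W' g'" "stratum W' g'"
      unfolding satake_strata_def stratum_def by blast
    have "rat_eq (R_map h \<tau> Orb W g) (R_map h \<tau> Orb W' g')" using eq p q ri by simp
    from rat_eq_imp_proportional[OF stratum[OF p(2)] stratum[OF q(2)] lines thick this]
    show "p = q"
      using satake_point_eq_iff[OF stratum[OF p(2)] stratum[OF q(2)]] by (simp add: p(1) q(1))
  qed
  then have "rat_inj_on (ri G K \<theta> \<tau> h Orb) P" if "P \<subseteq> satake_strata G K \<theta> \<tau> h" for P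
    using that unfolding rat_inj_on_def by blast
  then show ?thesis using ri unfolding stratum_def by (simp add: inj)
qed

end
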